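(* Let $(\Gamma,\preceq)$ be an ordered group such that $\preceq$ is not Conradian and such that the Conradian soul $C_{\preceq}(\Gamma)$ is non-trivial and admits only finitely many orderings. Let $\preceq_1,\preceq_2,\ldots,\preceq_{2^n}$ ($n\geq 1$) be all the orderings on $C_{\preceq}(\Gamma)$, where $\preceq_1$ is the restriction of $\preceq$, and for each $j$ let $\preceq^j$ be the ordering on $\Gamma$ which is the convex extension of $\preceq_j$ by $\preceq$. Then at least one of the orderings $\preceq^j$ is approximated by its conjugates.
   Context: An ordered group $(\Gamma,\preceq)$ is a group (possibly uncountable) with a total order relation (an ordering) invariant under left multiplication. The ordering is Conradian if for all $f\succ1$ and $g\succ 1$ there exists $n\in\mathbb{N}$ (positive integers) such that $fg^n\succ g$. A subgroup is $\preceq$-Conradian if the restriction of $\preceq$ to it is Conradian. A subset $T\subseteq\Gamma$ is $\preceq$-convex if whenever $f_1\prec f\prec f_2$ with $f_1,f_2\in T$ and $f\in\Gamma$, then $f\in T$. The Conradian soul $C_{\preceq}(\Gamma)$ is the (unique) subgroup which is $\preceq$-convex, $\preceq$-Conradian, and maximal among subgroups having these two properties simultaneously. It is known (Tararin) that if an orderable group has only finitely many orderings, then their number is a power of $2$ and all of them are Conradian. If $\Gamma_0$ is a $\preceq$-convex subgroup and $\preceq_*$ is an ordering on $\Gamma_0$, the (convex) extension of $\preceq_*$ by $\preceq$ is the ordering $\preceq^*$ on $\Gamma$ for which $1\prec^* f$ if and only if either $f\in\Gamma_0$ and $1\prec_* f$, or $f\notin\Gamma_0$ and $1\prec f$. $\mathcal{LO}(\Gamma)$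 denotes the set of all orderings on $\Gamma$, with the topology having as a subbasis the sets $U_f=\{\preceq\,:\, f\succ 1\}$ for $f\in\Gamma$, $f\neq 1$. The conjugates of an ordering with positive cone $P=\{g: g\succ 1\}$ are the orderings with positive cones $hPh^{-1}$, $h\in\Gamma$. An ordering is approximated by its conjugates if it is an accumulation point in $\mathcal{LO}(\Gamma)$ of its set of conjugates, i.e. every neighborhood of it contains a conjugate of it different from itself. *)

theory Defs
  imports "HOL-Algebra.Coset" "HOL-Analysis.Abstract_Topology"
begin

text \<open>An ordering is represented by its reflexive relation \<open>r\<close>, a subset of
  \<open>carrier G \<times> carrier G\<close>; the corresponding strict order is \<open>r - Id\<close>.\<close>

definition left_orderings :: "('a, 'b) monoid_scheme \<Rightarrow> 'a rel set" where
  "left_orderings G =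
    {r. linear_order_on (carrier G) r \<and>
        (\<forall>h\<in>carrier G. \<forall>(f, g)\<in>r. (h \<otimes>\<^bsub>G\<^esub> f, h \<otimes>\<^bsub>G\<^esub> g) \<in> r)}"

definition positive_cone :: "('a, 'b) monoid_scheme \<Rightarrow> 'a rel \<Rightarrow> 'a set" where
  "positive_cone G r = {g \<in> carrier G. (\<one>\<^bsub>G\<^esub>, g) \<in> r - Id}"

definition cone_relation :: "('a, 'b) monoid_scheme \<Rightarrow> 'a set \<Rightarrow> 'a rel" where
  "cone_relation G P =
    {(f, g). f \<in> carrier G \<and> g \<in> carrier G \<and> (f = g \<or> inv\<^bsub>G\<^esub> f \<otimes>\<^bsub>G\<^esub> g \<in> P)}"

definition conradian :: "('a, 'b) monoid_scheme \<Rightarrow> 'a rel \<Rightarrow> bool" where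
  "conradian G r \<longleftrightarrow>
    (\<forall>f\<in>positive_cone G r. \<forall>g\<in>positive_cone G r.
      \<exists>n::nat. n \<ge> 1 \<and> (g, f \<otimes>\<^bsub>G\<^esub> g [^]\<^bsub>G\<^esub> n) \<in> r - Id)"

definition order_convex :: "('a, 'b) monoid_scheme \<Rightarrow> 'a rel \<Rightarrow> 'a set \<Rightarrow> bool" where
  "order_convex G r T \<longleftrightarrow> T \<subseteq> carrier G \<and>
    (\<forall>f1\<in>T. \<forall>f2\<in>T. \<forall>f\<in>carrier G. (f1, f) \<in> r - Id \<and> (f, f2) \<in> r - Id \<longrightarrow> f \<in> T)"

definition convex_conradian_subgroup :: "('a, 'b) monoid_scheme \<Rightarrow> 'a rel \<Rightarrow> 'a set \<Rightarrow> bool" where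
  "convex_conradian_subgroup G r H \<longleftrightarrow>
    subgroup H G \<and> order_convex G r H \<and> conradian (G\<lparr>carrier := H\<rparr>) (Restr r H)"

definition is_conradian_soul :: "('a, 'b) monoid_scheme \<Rightarrow> 'a rel \<Rightarrow> 'a set \<Rightarrow> bool" where
  "is_conradian_soul G r C \<longleftrightarrow> convex_conradian_subgroup G r C \<and>
    (\<forall>H. convex_conradian_subgroup G r H \<and> C \<subseteq> H \<longrightarrow> H = C)"

definition conradian_soul :: "('a, 'b) monoid_scheme \<Rightarrow> 'a rel \<Rightarrow> 'a set" where
  "conradian_soul G r = (THE C. is_conradian_soul G r C)"

definition convex_extension ::
    "('a, 'b) monoid_scheme \<Rightarrow> 'a set \<Rightarrow> 'a rel \<Rightarrow> 'a rel \<Rightarrow> 'a rel" where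
  "convex_extension G H s r =
    cone_relation G {f \<in> carrier G.
      f \<in> H \<and> (\<one>\<^bsub>G\<^esub>, f) \<in> s - Id \<or> f \<notin> H \<and> (\<one>\<^bsub>G\<^esub>, f) \<in> r - Id}"

text \<open>The subbase is taken relative to the set of all orderings, so that the underlying
  space is \<^term>\<open>left_orderings G\<close> also when \<open>G\<close> is trivial and there are no sets \<open>U\<^sub>f\<close>.\<close>

definition left_orderings_topology :: "('a, 'b) monoid_scheme \<Rightarrow> 'a rel topology" where
  "left_orderings_topology G =
    topology (arbitrary union_of (finite intersection_of
      (\<lambda>U. \<exists>f\<in>carrier G - {\<one>\<^bsub>G\<^esub>}. U = {r \<in> left_orderings G. (\<one>\<^bsub>G\<^esub>, f) \<in> r - Id})
      relative_to left_orderings G))"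

definition conjugate_orderings :: "('a, 'b) monoid_scheme \<Rightarrow> 'a rel \<Rightarrow> 'a rel set" where
  "conjugate_orderings G r =
    {s \<in> left_orderings G. \<exists>h\<in>carrier G.
      positive_cone G s = (\<lambda>g. h \<otimes>\<^bsub>G\<^esub> g \<otimes>\<^bsub>G\<^esub> inv\<^bsub>G\<^esub> h) ` positive_cone G r}"

definition approximated_by_conjugates :: "('a, 'b) monoid_scheme \<Rightarrow> 'a rel \<Rightarrow> bool" where
  "approximated_by_conjugates G r \<longleftrightarrow>
    r \<in> left_orderings_topology G derived_set_of conjugate_orderings G r"

lemma (in group) positive_cone_cone_relation:
  assumes "P \<subseteq> carrier G" "\<one> \<notin> P"
  shows "positive_cone G (cone_relation G P) = P"
  using assms by (auto simp: positive_cone_def cone_relation_def)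

lemma (in group) positive_cone_convex_extension:
  "positive_cone G (convex_extension G H s r) =
    {f \<in> carrier G. f \<in> H \<and> (\<one>, f) \<in> s - Id \<or> f \<notin> H \<and> (\<one>, f) \<in> r - Id}"
  unfolding convex_extension_def by (rule positive_cone_cone_relation) auto

lemma (in group) convex_subgroups_chain:
  assumes r: "r \<in> left_orderings G"
    and H: "subgroup H G" "order_convex G r H" and K: "subgroup K G" "order_convex G r K"
  shows "H \<subseteq> K \<or> K \<subseteq> H"
proof (rule ccontr)
  assume "\<not> ?thesis"
  then obtain a b where a: "a \<in> H" "a \<notin> K" and b: "b \<in> K" "b \<notin> H"
    by blast
  have tot: "total_on (carrier G) r"
    and inv: "\<And>h f g. h \<in> carrier G \<Longrightarrow> (f, g) \<in> r \<Longrightarrow> (h \<otimes> f, h \<otimes> g) \<in> r"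
    using r by (auto simp: left_orderings_def linear_order_on_def)
  have pos: "\<exists>y\<in>M - N. (\<one>, y) \<in> r - Id"
    if "subgroup M G" "subgroup N G" "x \<in> M" "x \<notin> N" for M N x
  proof -
    have x: "x \<in> carrier G" "x \<noteq> \<one>"
      using that subgroup.one_closed[OF that(2)] by (auto dest: subgroup.mem_carrier)
    show ?thesis
    proof (cases "(\<one>, x) \<in> r")
      case True
      then show ?thesis using that x by auto
    next
      case False
      then have "(x, \<one>) \<in> r"
        using tot x by (auto simp: total_on_def)
      then have "(\<one>, inv x) \<in> r"
        using inv[of "inv x" x \<one>] x by simp
      moreover have "inv x \<in> M"
        using that(1,3) by (rule subgroup.m_inv_closed)
      moreover have "inv x \<notin> N"
        using subgroup.m_inv_closed[OF that(2), of "inv x"] that(4) x(1) by auto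
      moreover have "inv x \<noteq> \<one>"
        using x by (simp add: inv_eq_1_iff)
      ultimately show ?thesis by auto
    qed
  qed
  obtain x where x: "x \<in> H" "x \<notin> K" "(\<one>, x) \<in> r - Id"
    using pos[OF H(1) K(1) a] by blast
  obtain y where y: "y \<in> K" "y \<notin> H" "(\<one>, y) \<in> r - Id"
    using pos[OF K(1) H(1) b] by blast
  have xy: "x \<in> carrier G" "y \<in> carrier G" "x \<noteq> y" "\<one> \<in> H" "\<one> \<in> K"
    using x y H(1) K(1) by (auto dest: subgroup.mem_carrier subgroup.one_closed)
  then have "(x, y) \<in> r - Id \<or> (y, x) \<in> r - Id"
    using tot by (auto simp: total_on_def)
  then show False
  proof
    assume "(x, y) \<in> r - Id"
    then have "x \<in> K"
      using x(3) y(1) xy K(2) unfolding order_convex_def by blast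
    with x(2) show False ..
  next
    assume "(y, x) \<in> r - Id"
    then have "y \<in> H"
      using y(3) x(1) xy H(2) unfolding order_convex_def by blast
    with y(2) show False ..
  qed
qed

lemma (in group) is_conradian_soul_unique_existence:
  assumes r: "r \<in> left_orderings G"
  shows "\<exists>!C. is_conradian_soul G r C"
proof -
  define F where "F = {H. convex_conradian_subgroup G r H}"
  have chain: "H \<subseteq> K \<or> K \<subseteq> H" if "H \<in> F" "K \<in> F" for H K
    using that convex_subgroups_chain[OF r] by (auto simp: F_def convex_conradian_subgroup_def)
  have directed: "\<exists>M\<in>F. x \<in> M \<and> y \<in> M" if "x \<in> \<Union>F" "y \<in> \<Union>F" for x y
    using that chain by blast
  have sub: "subgroup H G" and cvx: "order_convex G r H"
    and con: "conradian (G\<lparr>carrier := H\<rparr>) (Restr r H)" if "H \<in> F" for H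
    using that by (auto simp: F_def convex_conradian_subgroup_def)
  have pow: "g [^]\<^bsub>G\<lparr>carrier := K\<rparr>\<^esub> n = g [^] n" for g K and n :: nat
    by (simp add: nat_pow_def)
  have "antisym r"
    using r by (simp add: left_orderings_def order_on_defs)
  then have "order_convex G r {\<one>}"
    by (auto simp: order_convex_def dest: antisymD)
  moreover have "conradian (G\<lparr>carrier := {\<one>}\<rparr>) (Restr r {\<one>})"
    by (auto simp: conradian_def positive_cone_def)
  ultimately have triv: "{\<one>} \<in> F"
    using triv_subgroup by (simp add: F_def convex_conradian_subgroup_def)
  have "subgroup (\<Union>F) G"
  proof
    show "\<Union>F \<subseteq> carrier G"
      using sub subgroup.subset by blast
    show "x \<otimes> y \<in> \<Union>F" if "x \<in> \<Union>F" "y \<in> \<Union>F" for x y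
    proof -
      obtain M where "M \<in> F" "x \<in> M" "y \<in> M"
        using directed[OF \<open>x \<in> \<Union>F\<close> \<open>y \<in> \<Union>F\<close>] by blast
      then show ?thesis
        using subgroup.m_closed[OF sub] by blast
    qed
    show "\<one> \<in> \<Union>F" using triv by blast
    show "inv x \<in> \<Union>F" if "x \<in> \<Union>F" for x
      using that subgroup.m_inv_closed[OF sub] by blast
  qed
  moreover have "order_convex G r (\<Union>F)"
    unfolding order_convex_def
  proof (intro conjI ballI impI)
    show "\<Union>F \<subseteq> carrier G"
      using sub subgroup.subset by blast
    fix f1 f2 f
    assume f: "f1 \<in> \<Union>F" "f2 \<in> \<Union>F" "f \<in> carrier G" "(f1, f) \<in> r - Id \<and> (f, f2) \<in> r - Id"
    obtain M where "M \<in> F" "f1 \<in> M" "f2 \<in> M"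
      using directed[OF f(1,2)] by blast
    then show "f \<in> \<Union>F"
      using cvx[of M] f(3,4) unfolding order_convex_def by blast
  qed
  moreover have "conradian (G\<lparr>carrier := \<Union>F\<rparr>) (Restr r (\<Union>F))"
    unfolding conradian_def
  proof (intro ballI)
    fix f g
    assume fg: "f \<in> positive_cone (G\<lparr>carrier := \<Union>F\<rparr>) (Restr r (\<Union>F))"
      "g \<in> positive_cone (G\<lparr>carrier := \<Union>F\<rparr>) (Restr r (\<Union>F))"
    then obtain M where M: "M \<in> F" "f \<in> M" "g \<in> M"
      using directed[of f g] unfolding positive_cone_def by auto
    then have "f \<in> positive_cone (G\<lparr>carrier := M\<rparr>) (Restr r M)"
      "g \<in> positive_cone (G\<lparr>carrier := M\<rparr>) (Restr r M)"
      using fg subgroup.one_closed[OF sub[OF M(1)]] by (simp_all add: positive_cone_def)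
    then obtain n :: nat where n: "n \<ge> 1"
      "(g, f \<otimes>\<^bsub>G\<lparr>carrier := M\<rparr>\<^esub> g [^]\<^bsub>G\<lparr>carrier := M\<rparr>\<^esub> n) \<in> Restr r M - Id"
      using con[OF M(1)] unfolding conradian_def by blast
    then have "(g, f \<otimes>\<^bsub>G\<lparr>carrier := \<Union>F\<rparr>\<^esub> g [^]\<^bsub>G\<lparr>carrier := \<Union>F\<rparr>\<^esub> n) \<in> Restr r (\<Union>F) - Id"
      using M(1) by (auto simp: pow)
    with n(1) show "\<exists>n::nat. n \<ge> 1 \<and>
        (g, f \<otimes>\<^bsub>G\<lparr>carrier := \<Union>F\<rparr>\<^esub> g [^]\<^bsub>G\<lparr>carrier := \<Union>F\<rparr>\<^esub> n) \<in> Restr r (\<Union>F) - Id"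
      by blast
  qed
  ultimately have top: "\<Union>F \<in> F"
    by (simp add: F_def convex_conradian_subgroup_def)
  show ?thesis
  proof (rule ex1I)
    show "is_conradian_soul G r (\<Union>F)"
      using top unfolding F_def is_conradian_soul_def by blast
    show "C = \<Union>F" if "is_conradian_soul G r C" for C
      using that top unfolding F_def is_conradian_soul_def by blast
  qed
qed

lemma (in group) is_conradian_soul_conradian_soul:
  assumes "r \<in> left_orderings G"
  shows "is_conradian_soul G r (conradian_soul G r)"
  unfolding conradian_soul_def
  by (rule theI'[OF is_conradian_soul_unique_existence[OF assms]])

end

theory Submission
  imports Defs
begin

text \<open>Write \<open>C\<close> for the Conradian soul. The orderings \<open>\<preceq>\<^sup>j\<close> are the orderings of \<open>G\<close> that agree with
  \<open>r\<close> outside \<open>C\<close>; in terms of positive cones, they are the cones that contain all elements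
  lying above \<open>C\<close> (\<open>far_cones\<close>). There are finitely many of them.

  The proof rests on ping-pong. Two elements \<open>f\<close>, \<open>g\<close> play ping-pong on a nonempty set \<open>I\<close> if both
  map \<open>I\<close> into itself by left multiplication and the coset of \<open>f \<otimes> x\<close> modulo \<open>C\<close> lies below that of
  \<open>g \<otimes> y\<close> for all \<open>x\<close>, \<open>y\<close> in \<open>I\<close>. A ping-pong set can be cut down to either of the two images, so an
  interval that is the union of two intervals without ping-pong sets has none itself
  (\<open>crossed_split\<close>). Hence \<open>no ping-pong set between a and b\<close> is a left-invariant equivalence
  relation with convex classes, and the class of \<open>\<one>\<close> is a convex subgroup. It is Conradian, since a
  pair violating Conrad's condition yields a ping-pong set (\<open>conradian_linked\<close>). By maximality of
  the soul, there is a ping-pong set between \<open>\<one>\<close> and any \<open>x\<close> above \<open>C\<close>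
  (\<open>crossed_above_conradian_soul\<close>).

  Conjugating a cone \<open>Q\<close> by \<open>w\<close> means to call \<open>a\<close> positive if it moves \<open>w\<close> up. If \<open>w\<close> lies between
  \<open>C\<close> and \<open>x\<close>, every element above \<open>x\<close> remains positive, and on \<open>C\<close> some ordering of \<open>C\<close> is
  induced. So conjugates by small \<open>w\<close> are close to one of the \<open>\<preceq>\<^sup>j\<close>. They cannot all be equal to one
  of them: on a ping-pong set some element outside \<open>C\<close> moves one point up and another one down,
  unless \<open>f\<close> and \<open>g\<close> lie in \<open>C\<close>, where they would make one of the induced orderings of \<open>C\<close>
  non-Conradian (\<open>ping_pong_conjugate_differs_outside\<close>); but a group with finitely many orderings
  has only Conradian ones (\<open>conradian_if_finite_left_orderings\<close>). Thus the conjugates of each \<open>\<preceq>\<^sup>i\<close>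
  accumulate at some \<open>\<preceq>\<^sup>j\<close> (\<open>far_cones_accumulate\<close>). Starting with an \<open>i\<close> whose orbit closure is
  minimal among the finitely many, the conjugates of \<open>\<preceq>\<^sup>i\<close> and those of \<open>\<preceq>\<^sup>j\<close> have the same closure,
  so \<open>\<preceq>\<^sup>j\<close> is approximated by its own conjugates (\<open>minimal_orbit_closure_accumulates\<close>).\<close>

section \<open>Positive cones\<close>

definition ordering_cone :: "('a, 'b) monoid_scheme \<Rightarrow> 'a set \<Rightarrow> bool" where
  "ordering_cone G P \<longleftrightarrow> P \<subseteq> carrier G \<and> \<one>\<^bsub>G\<^esub> \<notin> P \<and> (\<forall>x\<in>P. \<forall>y\<in>P. x \<otimes>\<^bsub>G\<^esub> y \<in> P) \<and>
    (\<forall>x\<in>carrier G. x = \<one>\<^bsub>G\<^esub> \<or> x \<in> P \<or> inv\<^bsub>G\<^esub> x \<in> P)"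

text \<open>The cone \<open>w P w\<^sup>-\<^sup>1\<close>, in the form that shows its dynamical meaning: \<open>a\<close> belongs to it if and
  only if \<open>w\<close> precedes \<open>a \<otimes> w\<close> in the ordering with cone \<open>P\<close>.\<close>

definition conjugate_cone :: "('a, 'b) monoid_scheme \<Rightarrow> 'a \<Rightarrow> 'a set \<Rightarrow> 'a set" where
  "conjugate_cone G w P = {a \<in> carrier G. inv\<^bsub>G\<^esub> w \<otimes>\<^bsub>G\<^esub> a \<otimes>\<^bsub>G\<^esub> w \<in> P}"

lemma ordering_coneD:
  assumes "ordering_cone G P"
  shows "x \<in> P \<Longrightarrow> x \<in> carrier G" "\<one>\<^bsub>G\<^esub> \<notin> P" "x \<in> P \<Longrightarrow> y \<in> P \<Longrightarrow> x \<otimes>\<^bsub>G\<^esub> y \<in> P"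
    "x \<in> carrier G \<Longrightarrow> x \<noteq> \<one>\<^bsub>G\<^esub> \<Longrightarrow> x \<notin> P \<Longrightarrow> inv\<^bsub>G\<^esub> x \<in> P"
  using assms unfolding ordering_cone_def by blast+

context group
begin

lemma inv_mult_cancel:
  assumes "x \<in> carrier G" "y \<in> carrier G"
  shows "inv x \<otimes> (x \<otimes> y) = y" "x \<otimes> (inv x \<otimes> y) = y"
  using assms by (simp_all flip: m_assoc)

lemmas group_word_simps = m_assoc inv_mult_group inv_mult_cancel

lemma ordering_cone_not_both:
  assumes "ordering_cone G P" "x \<in> P" "inv x \<in> P"
  shows False
  using ordering_coneD(1-3)[OF assms(1)] assms(2,3) by (metis r_inv)

text \<open>Of each pair \<open>x\<close>, \<open>inv x\<close> with \<open>x \<noteq> \<one>\<close> a cone contains exactly one, so that it cannot be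
  enlarged to another cone. This provides the separation of points that is needed in the space of
  orderings.\<close>

lemma ordering_cone_subset_eq:
  assumes "ordering_cone G P" "ordering_cone G Q" "P \<subseteq> Q"
  shows "P = Q"
proof
  show "Q \<subseteq> P"
  proof
    fix x assume x: "x \<in> Q"
    then have "x \<in> carrier G" "x \<noteq> \<one>"
      using ordering_coneD(1,2)[OF assms(2)] by auto
    then show "x \<in> P"
      using ordering_coneD(4)[OF assms(1)] ordering_cone_not_both[OF assms(2) x] assms(3) by blast
  qed
qed (rule assms(3))

lemma left_orderingsD:
  assumes "r \<in> left_orderings G"
  shows "(x, y) \<in> r \<Longrightarrow> x \<in> carrier G" "(x, y) \<in> r \<Longrightarrow> y \<in> carrier G"
    and "x \<in> carrier G \<Longrightarrow> (x, x) \<in> r"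
    and "(x, y) \<in> r \<Longrightarrow> (y, z) \<in> r \<Longrightarrow> (x, z) \<in> r"
    and "(x, y) \<in> r \<Longrightarrow> (y, x) \<in> r \<Longrightarrow> x = y"
    and "x \<in> carrier G \<Longrightarrow> y \<in> carrier G \<Longrightarrow> (x, y) \<notin> r \<Longrightarrow> (y, x) \<in> r"
    and "h \<in> carrier G \<Longrightarrow> (x, y) \<in> r \<Longrightarrow> (h \<otimes> x, h \<otimes> y) \<in> r"
proof -
  have lin: "linear_order_on (carrier G) r"
    and inv: "\<And>h f g. h \<in> carrier G \<Longrightarrow> (f, g) \<in> r \<Longrightarrow> (h \<otimes> f, h \<otimes> g) \<in> r"
    using assms by (auto simp: left_orderings_def)
  note facts = lin[unfolded linear_order_on_def partial_order_on_def preorder_on_def]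
  show "(x, y) \<in> r \<Longrightarrow> x \<in> carrier G" "(x, y) \<in> r \<Longrightarrow> y \<in> carrier G"
    using facts by auto
  show refl: "x \<in> carrier G \<Longrightarrow> (x, x) \<in> r" for x
    using facts by (auto dest: refl_onD)
  show "(x, y) \<in> r \<Longrightarrow> (y, z) \<in> r \<Longrightarrow> (x, z) \<in> r"
    using facts by (meson transD)
  show "(x, y) \<in> r \<Longrightarrow> (y, x) \<in> r \<Longrightarrow> x = y"
    using facts by (meson antisymD)
  show "x \<in> carrier G \<Longrightarrow> y \<in> carrier G \<Longrightarrow> (x, y) \<notin> r \<Longrightarrow> (y, x) \<in> r"
    using facts refl unfolding total_on_def by metis
  show "h \<in> carrier G \<Longrightarrow> (x, y) \<in> r \<Longrightarrow> (h \<otimes> x, h \<otimes> y) \<in> r"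
    by (rule inv)
qed

lemma less_le_trans:
  assumes r: "r \<in> left_orderings G" and "(x, y) \<in> r - Id" "(y, z) \<in> r"
  shows "(x, z) \<in> r - Id"
proof -
  have "x \<noteq> z" using left_orderingsD(5)[OF r, of x y] assms(2,3) by auto
  then show ?thesis using left_orderingsD(4)[OF r, of x y z] assms(2,3) by auto
qed

lemma less_iff_positive_cone:
  assumes "r \<in> left_orderings G" "x \<in> carrier G" "y \<in> carrier G"
  shows "(x, y) \<in> r - Id \<longleftrightarrow> inv x \<otimes> y \<in> positive_cone G r"
proof
  assume "(x, y) \<in> r - Id"
  then show "inv x \<otimes> y \<in> positive_cone G r"
    using left_orderingsD(7)[OF assms(1), of "inv x" x y] assms(2,3)
    by (auto simp: positive_cone_def inv_solve_left)
next
  assume "inv x \<otimes> y \<in> positive_cone G r"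
  then show "(x, y) \<in> r - Id"
    using left_orderingsD(7)[OF assms(1), of x \<one> "inv x \<otimes> y"] assms(2,3)
    by (auto simp: positive_cone_def inv_mult_cancel)
qed

lemma ordering_cone_positive_cone:
  assumes r: "r \<in> left_orderings G"
  shows "ordering_cone G (positive_cone G r)"
  unfolding ordering_cone_def
proof (intro conjI ballI)
  fix x y assume xy: "x \<in> positive_cone G r" "y \<in> positive_cone G r"
  then have c: "x \<in> carrier G" "y \<in> carrier G" and less: "(\<one>, x) \<in> r - Id" "(\<one>, y) \<in> r - Id"
    by (auto simp: positive_cone_def)
  have "(x, x \<otimes> y) \<in> r - Id"
    using c xy less_iff_positive_cone[OF r, of x "x \<otimes> y"] by (simp add: inv_mult_cancel)
  then have "(\<one>, x \<otimes> y) \<in> r - Id"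
    using less_le_trans[OF r less(1)] by blast
  then show "x \<otimes> y \<in> positive_cone G r"
    using c by (simp add: positive_cone_def)
next
  fix x assume x: "x \<in> carrier G"
  have "x = \<one> \<or> (\<one>, x) \<in> r - Id \<or> (x, \<one>) \<in> r - Id"
    using left_orderingsD(6)[OF r] x by auto
  then show "x = \<one> \<or> x \<in> positive_cone G r \<or> inv x \<in> positive_cone G r"
    using less_iff_positive_cone[OF r, of x \<one>] less_iff_positive_cone[OF r, of \<one> x] x by auto
qed (auto simp: positive_cone_def)

lemma cone_relation_in_left_orderings:
  assumes P: "ordering_cone G P"
  shows "cone_relation G P \<in> left_orderings G"
proof -
  note PD = ordering_coneD[OF P]
  have trans: "inv x \<otimes> z \<in> P" if "x \<in> carrier G" "y \<in> carrier G" "z \<in> carrier G"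
    "inv x \<otimes> y \<in> P" "inv y \<otimes> z \<in> P" for x y z
    using PD(3)[OF that(4,5)] that(1-3) by (simp add: group_word_simps)
  have nsym: False if "x \<in> carrier G" "y \<in> carrier G" "inv x \<otimes> y \<in> P" "inv y \<otimes> x \<in> P" for x y
    using ordering_cone_not_both[OF P that(3)] that by (simp add: inv_mult_group)
  have tot: "inv x \<otimes> y \<in> P \<or> inv y \<otimes> x \<in> P" if "x \<in> carrier G" "y \<in> carrier G" "x \<noteq> y" for x y
    using PD(4)[of "inv x \<otimes> y"] that by (auto simp: inv_mult_group inv_solve_left')
  have "linear_order_on (carrier G) (cone_relation G P)"
    unfolding order_on_defs
  proof (intro conjI)
    show "cone_relation G P \<subseteq> carrier G \<times> carrier G"
      by (auto simp: cone_relation_def)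
    show "refl_on (carrier G) (cone_relation G P)"
      by (auto simp: cone_relation_def refl_on_def)
    show "trans (cone_relation G P)"
      by (rule transI) (auto simp: cone_relation_def intro: trans)
    show "antisym (cone_relation G P)"
      by (rule antisymI) (auto simp: cone_relation_def dest: nsym)
    show "total_on (carrier G) (cone_relation G P)"
      using tot by (auto simp: cone_relation_def total_on_def)
  qed
  then show ?thesis
    by (auto simp: left_orderings_def cone_relation_def group_word_simps)
qed

lemma conjugate_cone_mult:
  assumes "v \<in> carrier G" "w \<in> carrier G"
  shows "conjugate_cone G (v \<otimes> w) P = conjugate_cone G v (conjugate_cone G w P)"
  using assms by (auto simp: conjugate_cone_def group_word_simps)

text \<open>The ordering of the subgroup induced by the orbit of \<open>w\<close>: it compares \<open>a\<close> and \<open>b\<close> by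
  comparing \<open>a \<otimes> w\<close> and \<open>b \<otimes> w\<close>.\<close>

lemma ordering_cone_conjugate_Int_subgroup:
  assumes P: "ordering_cone G P" and H: "subgroup H G" and w: "w \<in> carrier G"
  shows "ordering_cone (G\<lparr>carrier := H\<rparr>) (conjugate_cone G w P \<inter> H)"
proof -
  note PD = ordering_coneD[OF P]
  note Hc = subgroup.mem_carrier[OF H]
  have mult: "inv w \<otimes> (x \<otimes> y) \<otimes> w \<in> P"
    if "x \<in> carrier G" "y \<in> carrier G" "inv w \<otimes> x \<otimes> w \<in> P" "inv w \<otimes> y \<otimes> w \<in> P" for x y
    using PD(3)[OF that(3,4)] that(1,2) w by (simp add: group_word_simps)
  have "inv w \<otimes> inv x \<otimes> w \<in> P" if "x \<in> carrier G" "x \<noteq> \<one>" "inv w \<otimes> x \<otimes> w \<notin> P" for x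
  proof -
    have "inv w \<otimes> x \<otimes> w \<noteq> \<one>"
      using that(1,2) w
      by (metis inv_closed inv_solve_left' inv_solve_right l_one m_assoc m_closed r_inv r_one)
    then show ?thesis
      using PD(4)[of "inv w \<otimes> x \<otimes> w"] that w by (simp add: group_word_simps)
  qed
  then show ?thesis
    using mult PD(2) w Hc subgroup.m_closed[OF H] subgroup.m_inv_closed[OF H]
    by (auto simp: ordering_cone_def conjugate_cone_def m_inv_consistent[OF H])
qed

lemma conjugate_cone_subset: "conjugate_cone G w P \<subseteq> carrier G"
  by (auto simp: conjugate_cone_def)

lemma ordering_cone_conjugate:
  assumes "ordering_cone G P" "w \<in> carrier G"
  shows "ordering_cone G (conjugate_cone G w P)"
  using ordering_cone_conjugate_Int_subgroup[OF assms(1) subgroup_self assms(2)]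
  by (simp add: Int_absorb2[OF conjugate_cone_subset])

lemma conjugate_orderingI:
  assumes P: "ordering_cone G P" and w: "w \<in> carrier G"
  shows "cone_relation G (conjugate_cone G w P) \<in> conjugate_orderings G (cone_relation G P)"
proof -
  note PD = ordering_coneD[OF P]
  have Pw: "ordering_cone G (conjugate_cone G w P)"
    by (rule ordering_cone_conjugate[OF P w])
  have pos: "positive_cone G (cone_relation G Q) = Q" if "ordering_cone G Q" for Q
    using that by (intro positive_cone_cone_relation) (auto simp: ordering_cone_def)
  have "conjugate_cone G w P = (\<lambda>g. w \<otimes> g \<otimes> inv w) ` P"
  proof (intro equalityI subsetI)
    fix a assume "a \<in> conjugate_cone G w P"
    then show "a \<in> (\<lambda>g. w \<otimes> g \<otimes> inv w) ` P"
      using w by (intro image_eqI[of _ _ "inv w \<otimes> a \<otimes> w"])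
        (auto simp: conjugate_cone_def group_word_simps)
  qed (use w PD(1) in \<open>auto simp: conjugate_cone_def group_word_simps\<close>)
  then show ?thesis
    using w cone_relation_in_left_orderings[OF Pw] pos[OF P] pos[OF Pw]
    by (auto simp: conjugate_orderings_def)
qed

end

section \<open>Neighbourhoods in the space of orderings\<close>

text \<open>A topology-free form of: the cone \<open>P\<close> is an accumulation point of the conjugates of \<open>Q\<close>. The
  cones containing a given finite subset of \<open>P\<close> form a neighbourhood basis of \<open>P\<close>.\<close>

definition accumulates_at :: "('a, 'b) monoid_scheme \<Rightarrow> 'a set \<Rightarrow> 'a set \<Rightarrow> bool" where
  "accumulates_at G Q P \<longleftrightarrow> (\<forall>F. finite F \<and> F \<subseteq> P \<longrightarrow>
    (\<exists>w\<in>carrier G. conjugate_cone G w Q \<noteq> P \<and> F \<subseteq> conjugate_cone G w Q))"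

lemma left_orderings_neighbourhood:
  assumes open_U: "openin (left_orderings_topology G) U" and r: "r \<in> U"
  obtains F where "finite F" "F \<subseteq> positive_cone G r"
    "\<And>s. s \<in> left_orderings G \<Longrightarrow> F \<subseteq> positive_cone G s \<Longrightarrow> s \<in> U"
proof -
  let ?B = "\<lambda>U. \<exists>f\<in>carrier G - {\<one>\<^bsub>G\<^esub>}. U = {r \<in> left_orderings G. (\<one>\<^bsub>G\<^esub>, f) \<in> r - Id}"
  obtain N where N: "r \<in> N" "N \<subseteq> U" "(finite intersection_of ?B relative_to left_orderings G) N"
    using open_U r unfolding left_orderings_topology_def openin_subbase
    by (auto simp: union_of_def)
  then obtain V where V: "finite V" "V \<subseteq> Collect ?B" "left_orderings G \<inter> \<Inter>V = N"
    unfolding relative_to_def intersection_of_def by blast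
  have "\<forall>W\<in>V. \<exists>f. f \<in> carrier G \<and> W = {r \<in> left_orderings G. (\<one>\<^bsub>G\<^esub>, f) \<in> r - Id}"
    using V(2) by blast
  then have "\<exists>e. \<forall>W\<in>V. e W \<in> carrier G \<and> W = {r \<in> left_orderings G. (\<one>\<^bsub>G\<^esub>, e W) \<in> r - Id}"
    by (rule bchoice)
  then obtain e where e: "\<And>W. W \<in> V \<Longrightarrow> e W \<in> carrier G"
    "\<And>W. W \<in> V \<Longrightarrow> W = {r \<in> left_orderings G. (\<one>\<^bsub>G\<^esub>, e W) \<in> r - Id}"
    by (elim exE) blast
  show thesis
  proof (rule that[of "e ` V"])
    show "finite (e ` V)" using V(1) by simp
    show "e ` V \<subseteq> positive_cone G r"
    proof (rule image_subsetI)
      fix W assume "W \<in> V"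
      then have "r \<in> W" using N(1) V(3) by blast
      then show "e W \<in> positive_cone G r"
        using e[OF \<open>W \<in> V\<close>] by (auto simp: positive_cone_def)
    qed
    show "s \<in> U" if s: "s \<in> left_orderings G" "e ` V \<subseteq> positive_cone G s" for s
    proof -
      have "s \<in> W" if "W \<in> V" for W
        using e(2)[OF that] s that by (auto simp: positive_cone_def)
      then show ?thesis using s(1) V(3) N(2) by blast
    qed
  qed
qed

context group
begin

lemma approximated_by_conjugates_if_accumulates:
  assumes P: "ordering_cone G P" and acc: "accumulates_at G P P"
  shows "approximated_by_conjugates G (cone_relation G P)"
  unfolding approximated_by_conjugates_def in_derived_set_of
proof (intro conjI allI impI)
  have pos: "positive_cone G (cone_relation G Q) = Q" if "ordering_cone G Q" for Q
    using that by (intro positive_cone_cone_relation) (auto simp: ordering_cone_def)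
  show "cone_relation G P \<in> topspace (left_orderings_topology G)"
    unfolding left_orderings_topology_def
    using cone_relation_in_left_orderings[OF P] by simp
  fix U assume "cone_relation G P \<in> U \<and> openin (left_orderings_topology G) U"
  then have U: "openin (left_orderings_topology G) U" "cone_relation G P \<in> U" by auto
  obtain F where F: "finite F" "F \<subseteq> P"
    "\<And>s. s \<in> left_orderings G \<Longrightarrow> F \<subseteq> positive_cone G s \<Longrightarrow> s \<in> U"
    by (rule left_orderings_neighbourhood[OF U, unfolded pos[OF P]]) (rule that; blast)
  obtain w where w: "w \<in> carrier G" "conjugate_cone G w P \<noteq> P" "F \<subseteq> conjugate_cone G w P"
    using acc[unfolded accumulates_at_def, rule_format, of F] F(1,2) by blast
  let ?s = "cone_relation G (conjugate_cone G w P)"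
  have Pw: "ordering_cone G (conjugate_cone G w P)"
    by (rule ordering_cone_conjugate[OF P w(1)])
  have "?s \<noteq> cone_relation G P"
    using w(2) pos[OF P] pos[OF Pw] by metis
  moreover have "?s \<in> U"
    using F(3) w(3) cone_relation_in_left_orderings[OF Pw] pos[OF Pw] by simp
  ultimately show "\<exists>y. y \<noteq> cone_relation G P \<and>
      y \<in> conjugate_orderings G (cone_relation G P) \<and> y \<in> U"
    using conjugate_orderingI[OF P w(1)] by blast
qed

text \<open>This holds for a group acting by homeomorphisms on any \<open>T\<^sub>1\<close> space: if the orbit of each point
  of a finite set accumulates at some point of that set, take a point \<open>Q\<close> whose orbit closure is
  minimal, and let its orbit accumulate at \<open>P\<close>. The orbit closure of \<open>P\<close> lies in that of \<open>Q\<close>, so they are equal, and the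
  conjugates of \<open>Q\<close> near \<open>P\<close> are in turn limits of conjugates of \<open>P\<close>.\<close>

lemma minimal_orbit_closure_accumulates:
  assumes fin: "finite \<P>" "\<P> \<noteq> {}" and cones: "\<And>P. P \<in> \<P> \<Longrightarrow> ordering_cone G P"
    and succ: "\<And>Q. Q \<in> \<P> \<Longrightarrow> \<exists>P\<in>\<P>. accumulates_at G Q P"
  shows "\<exists>P\<in>\<P>. accumulates_at G P P"
proof -
  define orbit_closure where "orbit_closure = (\<lambda>Q. {P. P \<subseteq> carrier G \<and>
    (\<forall>F. finite F \<and> F \<subseteq> P \<longrightarrow> (\<exists>w\<in>carrier G. F \<subseteq> conjugate_cone G w Q))})"
  have transfer: "\<exists>v\<in>carrier G. F \<subseteq> conjugate_cone G v Q"
    if P: "P \<in> orbit_closure Q" and w: "w \<in> carrier G" and F: "finite F" "F \<subseteq> conjugate_cone G w P"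
    for P Q w F
  proof -
    have "finite ((\<lambda>a. inv w \<otimes> a \<otimes> w) ` F)" "(\<lambda>a. inv w \<otimes> a \<otimes> w) ` F \<subseteq> P"
      using F by (auto simp: conjugate_cone_def)
    then obtain v where v: "v \<in> carrier G" "(\<lambda>a. inv w \<otimes> a \<otimes> w) ` F \<subseteq> conjugate_cone G v Q"
      using P unfolding orbit_closure_def by blast
    have "F \<subseteq> conjugate_cone G w (conjugate_cone G v Q)"
      using v(2) F(2) by (auto simp: conjugate_cone_def)
    then show ?thesis
      using conjugate_cone_mult[OF w v(1)] w v(1) by (intro bexI[of _ "w \<otimes> v"]) auto
  qed
  have refl: "P \<in> orbit_closure P" if "P \<in> \<P>" for P
    using ordering_coneD(1)[OF cones[OF that]]
    by (auto simp: orbit_closure_def conjugate_cone_def intro!: bexI[of _ \<one>])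
  have trans: "orbit_closure P \<subseteq> orbit_closure Q" if "P \<in> orbit_closure Q" for P Q
  proof
    fix R assume R: "R \<in> orbit_closure P"
    have "\<exists>v\<in>carrier G. F \<subseteq> conjugate_cone G v Q" if "finite F" "F \<subseteq> R" for F
    proof -
      obtain w where "w \<in> carrier G" "F \<subseteq> conjugate_cone G w P"
        using R \<open>finite F\<close> \<open>F \<subseteq> R\<close> unfolding orbit_closure_def by blast
      then show ?thesis
        using transfer[OF \<open>P \<in> orbit_closure Q\<close>] \<open>finite F\<close> by blast
    qed
    then show "R \<in> orbit_closure Q"
      using R unfolding orbit_closure_def by blast
  qed
  obtain Q where Q: "Q \<in> \<P>"
    and min: "\<And>P. P \<in> \<P> \<Longrightarrow> orbit_closure P \<subseteq> orbit_closure Q \<Longrightarrow> orbit_closure Q = orbit_closure P"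
    using finite_has_minimal[of "orbit_closure ` \<P>"] fin by auto
  obtain P where P: "P \<in> \<P>" and acc: "accumulates_at G Q P"
    using succ[OF Q] by blast
  have PQ: "P \<in> orbit_closure Q"
    using acc ordering_coneD(1)[OF cones[OF P]] unfolding orbit_closure_def accumulates_at_def
    by blast
  have QP: "Q \<in> orbit_closure P"
    using min[OF P trans[OF PQ]] refl[OF Q] by blast
  have "accumulates_at G P P"
    unfolding accumulates_at_def
  proof (intro allI impI)
    fix F assume F: "finite F \<and> F \<subseteq> P"
    then obtain w where w: "w \<in> carrier G" "conjugate_cone G w Q \<noteq> P" "F \<subseteq> conjugate_cone G w Q"
      using acc[unfolded accumulates_at_def, rule_format, of F] by blast
    have "\<not> conjugate_cone G w Q \<subseteq> P"
      using ordering_cone_subset_eq[OF ordering_cone_conjugate[OF cones[OF Q] w(1)] cones[OF P]] w(2)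
      by blast
    then obtain f where f: "f \<in> conjugate_cone G w Q" "f \<notin> P"
      by blast
    obtain v where v: "v \<in> carrier G" "insert f F \<subseteq> conjugate_cone G v P"
      using transfer[OF QP w(1), of "insert f F"] F w(3) f(1) by auto
    then show "\<exists>w\<in>carrier G. conjugate_cone G w P \<noteq> P \<and> F \<subseteq> conjugate_cone G w P"
      using f(2) by blast
  qed
  with P show ?thesis by blast
qed

section \<open>Groups with finitely many orderings\<close>

text \<open>If there are only finitely many conjugates, some power \<open>g [^] m\<close> with \<open>m > 0\<close> normalises the
  positive cone, so that right multiplication by it preserves the order. Then
  \<open>f \<otimes> g [^] m\<close> exceeds \<open>g [^] m\<close>, which is at least \<open>g\<close>.\<close>

lemma conradian_if_finite_left_orderings:
  assumes fin: "finite (left_orderings G)" and r: "r \<in> left_orderings G"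
  shows "conradian G r"
  unfolding conradian_def
proof (intro ballI)
  fix f g assume fg: "f \<in> positive_cone G r" "g \<in> positive_cone G r"
  let ?P = "positive_cone G r"
  have P: "ordering_cone G ?P" by (rule ordering_cone_positive_cone[OF r])
  note PD = ordering_coneD[OF P]
  have c: "f \<in> carrier G" "g \<in> carrier G" using fg PD(1) by auto
  let ?o = "\<lambda>k::nat. cone_relation G (conjugate_cone G (g [^] k) ?P)"
  have cone: "ordering_cone G (conjugate_cone G (g [^] k) ?P)" for k :: nat
    using ordering_cone_conjugate[OF P] c by simp
  have "\<not> inj ?o"
    using finite_subset[OF _ fin, of "range ?o"] cone_relation_in_left_orderings[OF cone]
    by (auto dest!: range_inj_infinite)
  then obtain i j where ij: "i < j" "?o i = ?o j"
    unfolding inj_def by (metis nat_neq_iff)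
  have eq: "conjugate_cone G (g [^] i) ?P = conjugate_cone G (g [^] j) ?P"
    using ij(2) positive_cone_cone_relation cone unfolding ordering_cone_def by metis
  obtain m where m: "j = i + Suc m" using ij(1) less_imp_Suc_add by auto
  have "g [^] i \<otimes> f \<otimes> inv (g [^] i) \<in> conjugate_cone G (g [^] i) ?P"
    using c fg by (simp add: conjugate_cone_def group_word_simps)
  then have "inv (g [^] j) \<otimes> (g [^] i \<otimes> f \<otimes> inv (g [^] i)) \<otimes> g [^] j \<in> ?P"
    using eq unfolding conjugate_cone_def by blast
  moreover have "g [^] j = g [^] i \<otimes> g [^] Suc m"
    using m c nat_pow_mult[of g i "Suc m"] by simp
  ultimately have conj: "inv (g [^] Suc m) \<otimes> f \<otimes> g [^] Suc m \<in> ?P"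
    using c by (simp del: nat_pow_Suc add: group_word_simps)
  have "g [^] m = \<one> \<or> g [^] m \<in> ?P"
  proof (induction m)
    case (Suc m)
    then show ?case using fg(2) PD(3)[of "g [^] m" g] c by auto
  qed simp
  then have "g [^] m \<otimes> (inv (g [^] Suc m) \<otimes> f \<otimes> g [^] Suc m) \<in> ?P"
    using conj PD(3)[OF _ conj, of "g [^] m"] PD(1)[OF conj] by auto
  moreover have "g [^] m \<otimes> (inv (g [^] Suc m) \<otimes> f \<otimes> g [^] Suc m) = inv g \<otimes> (f \<otimes> g [^] Suc m)"
    using c nat_pow_Suc2[of g m] by (simp del: nat_pow_Suc add: group_word_simps)
  ultimately have "(g, f \<otimes> g [^] Suc m) \<in> r - Id"
    using less_iff_positive_cone[OF r, of g "f \<otimes> g [^] Suc m"] c by simp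
  then show "\<exists>n::nat. n \<ge> 1 \<and> (g, f \<otimes> g [^] n) \<in> r - Id"
    by (intro exI[of _ "Suc m"]) simp
qed

text \<open>The same for the orderings of a subgroup, with the operations of the ambient group.\<close>

lemma ordering_cone_subgroup_conradian:
  assumes H: "subgroup H G" and fin: "finite (left_orderings (G\<lparr>carrier := H\<rparr>))"
    and A: "ordering_cone (G\<lparr>carrier := H\<rparr>) A" and fg: "f \<in> A" "g \<in> A"
  obtains n :: nat where "inv g \<otimes> (f \<otimes> g [^] n) \<in> A"
proof -
  interpret H: group "G\<lparr>carrier := H\<rparr>"
    using subgroup.subgroup_is_group[OF H] is_group by blast
  let ?r = "cone_relation (G\<lparr>carrier := H\<rparr>) A"
  have r: "?r \<in> left_orderings (G\<lparr>carrier := H\<rparr>)"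
    by (rule H.cone_relation_in_left_orderings[OF A])
  have pos: "positive_cone (G\<lparr>carrier := H\<rparr>) ?r = A"
    using A by (intro H.positive_cone_cone_relation) (auto simp: ordering_cone_def)
  have fgH: "f \<in> H" "g \<in> H" using ordering_coneD(1)[OF A] fg by auto
  have "\<exists>n::nat. (g, f \<otimes> g [^] n) \<in> ?r - Id"
    using H.conradian_if_finite_left_orderings[OF fin r, unfolded conradian_def pos] fg
    by (fastforce simp flip: nat_pow_consistent)
  then obtain n :: nat where "(g, f \<otimes> g [^] n) \<in> ?r - Id" ..
  moreover have "f \<otimes> g [^] n \<in> H"
    using \<open>(g, f \<otimes> g [^] n) \<in> ?r - Id\<close> by (auto simp: cone_relation_def)
  ultimately have "inv g \<otimes> (f \<otimes> g [^] n) \<in> A"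
    using H.less_iff_positive_cone[OF r, of g "f \<otimes> g [^] n"] fgH pos m_inv_consistent[OF H]
    by simp
  then show thesis by (rule that)
qed

lemma conradian_Restr_iff:
  assumes H: "subgroup H G"
  shows "conradian (G\<lparr>carrier := H\<rparr>) (Restr r H) \<longleftrightarrow>
    (\<forall>f\<in>H. \<forall>g\<in>H. (\<one>, f) \<in> r - Id \<and> (\<one>, g) \<in> r - Id \<longrightarrow>
      (\<exists>n::nat. n \<ge> 1 \<and> (g, f \<otimes> g [^] n) \<in> r - Id))"
proof -
  have pow: "g [^] n \<in> H" if "g \<in> H" for g and n :: nat
    using that subgroup.one_closed[OF H] subgroup.m_closed[OF H] by (induction n) auto
  have "positive_cone (G\<lparr>carrier := H\<rparr>) (Restr r H) = {f \<in> H. (\<one>, f) \<in> r - Id}"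
    using subgroup.one_closed[OF H] by (auto simp: positive_cone_def)
  then show ?thesis
    using pow subgroup.m_closed[OF H]
    by (auto simp: conradian_def simp flip: nat_pow_consistent)
qed

end

section \<open>Comparison modulo a convex subgroup\<close>

locale left_ordered_group_with_convex_subgroup = group G for G (structure) +
  fixes r C
  assumes ordering: "r \<in> left_orderings G"
    and subgroup_C: "subgroup C G"
    and convex_C: "order_convex G r C"
begin

lemmas r_carrier = left_orderingsD(1,2)[OF ordering]
  and r_refl = left_orderingsD(3)[OF ordering]
  and r_trans = left_orderingsD(4)[OF ordering]
  and r_antisym = left_orderingsD(5)[OF ordering]
  and r_total = left_orderingsD(6)[OF ordering]
  and r_left = left_orderingsD(7)[OF ordering]

lemmas C_carrier = subgroup.mem_carrier[OF subgroup_C]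
  and C_one = subgroup.one_closed[OF subgroup_C]
  and C_mult = subgroup.m_closed[OF subgroup_C]
  and C_inv = subgroup.m_inv_closed[OF subgroup_C]

lemma C_between:
  assumes "a \<in> C" "b \<in> C" "(a, x) \<in> r" "(x, b) \<in> r"
  shows "x \<in> C"
proof (cases "x = a \<or> x = b")
  case False
  then show ?thesis
    using assms convex_C r_carrier(1)[OF assms(4)] unfolding order_convex_def by blast
qed (use assms in auto)

text \<open>The strict order on the left cosets of \<open>C\<close>, seen on the elements: \<open>far x y\<close> means that the
  coset of \<open>x\<close> lies entirely below the coset of \<open>y\<close>.\<close>

definition far :: "'a \<Rightarrow> 'a \<Rightarrow> bool" where
  "far x y \<longleftrightarrow> (x, y) \<in> r \<and> inv x \<otimes> y \<notin> C"

lemma far_le: "far x y \<Longrightarrow> (x, y) \<in> r"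
  by (simp add: far_def)

lemma far_carrier: "far x y \<Longrightarrow> x \<in> carrier G" "far x y \<Longrightarrow> y \<in> carrier G"
  using far_le[of x y] r_carrier[of x y] by blast+

lemma far_left:
  assumes "far x y" "h \<in> carrier G"
  shows "far (h \<otimes> x) (h \<otimes> y)"
  using assms far_carrier[OF assms(1)] r_left[OF assms(2), of x y]
  by (simp add: far_def group_word_simps)

lemma far_iff_one:
  assumes "x \<in> carrier G" "y \<in> carrier G"
  shows "far x y \<longleftrightarrow> far \<one> (inv x \<otimes> y)"
proof
  show "far \<one> (inv x \<otimes> y)" if "far x y"
    using far_left[OF that, of "inv x"] assms by simp
  show "far x y" if "far \<one> (inv x \<otimes> y)"
    using far_left[OF that, of x] assms by (simp add: inv_mult_cancel)
qed

lemma far_le_trans: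
  assumes "far x y" "(y, z) \<in> r"
  shows "far x z"
proof -
  have c: "x \<in> carrier G" "y \<in> carrier G" "z \<in> carrier G"
    using far_carrier[OF assms(1)] r_carrier[OF assms(2)] by auto
  have "(\<one>, inv x \<otimes> y) \<in> r" "(inv x \<otimes> y, inv x \<otimes> z) \<in> r"
    using r_left[of "inv x" x y] r_left[OF _ assms(2), of "inv x"] far_le[OF assms(1)] c by auto
  then have "inv x \<otimes> z \<notin> C"
    using C_between[OF C_one] assms(1) unfolding far_def by blast
  then show ?thesis
    using r_trans[OF far_le[OF assms(1)] assms(2)] by (simp add: far_def)
qed

lemma le_far_trans:
  assumes "(x, y) \<in> r" "far y z"
  shows "far x z"
proof -
  have c: "x \<in> carrier G" "y \<in> carrier G" "z \<in> carrier G"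
    using r_carrier[OF assms(1)] far_carrier[OF assms(2)] by auto
  have le: "(\<one>, inv x \<otimes> y) \<in> r" "(inv x \<otimes> y, inv x \<otimes> z) \<in> r"
    using r_left[OF _ assms(1), of "inv x"] r_left[OF _ far_le[OF assms(2)], of "inv x"] c by auto
  have "inv x \<otimes> z \<notin> C"
  proof
    assume z: "inv x \<otimes> z \<in> C"
    then have "inv (inv x \<otimes> y) \<otimes> (inv x \<otimes> z) \<in> C"
      using C_between[OF C_one z le] C_mult C_inv by blast
    then show False
      using assms(2) c by (simp add: far_def group_word_simps)
  qed
  then show ?thesis
    using r_trans[OF assms(1) far_le[OF assms(2)]] by (simp add: far_def)
qed

lemma far_trans: "far x y \<Longrightarrow> far y z \<Longrightarrow> far x z"
  using far_le_trans far_le by blast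

lemma not_far_self: "\<not> far x x"
proof
  assume x: "far x x"
  show False
    using x C_one far_carrier(1)[OF x] by (simp add: far_def)
qed

lemma far_one_iff: "far \<one> x \<longleftrightarrow> (\<one>, x) \<in> r \<and> x \<notin> C"
proof (cases "x \<in> carrier G")
  case False
  then show ?thesis using far_le r_carrier(2) by blast
qed (simp add: far_def)

lemma far_one_or_inv:
  assumes "x \<in> carrier G" "x \<notin> C"
  shows "far \<one> x \<or> far \<one> (inv x)"
proof -
  have "(\<one>, x) \<in> r \<or> (\<one>, inv x) \<in> r"
    using r_total[of \<one> x] r_left[of "inv x" x \<one>] assms(1) by auto
  moreover have "inv x \<notin> C"
    using C_inv[of "inv x"] assms by auto
  ultimately show ?thesis
    using assms(2) by (auto simp: far_one_iff)
qed

lemma far_mult_C: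
  assumes "far x y" "c \<in> C"
  shows "far x (y \<otimes> c)"
proof -
  have c: "x \<in> carrier G" "y \<in> carrier G" "c \<in> carrier G"
    using far_carrier[OF assms(1)] C_carrier[OF assms(2)] by auto
  have n: "inv x \<otimes> (y \<otimes> c) \<notin> C"
  proof
    assume "inv x \<otimes> (y \<otimes> c) \<in> C"
    then have "inv x \<otimes> (y \<otimes> c) \<otimes> inv c \<in> C"
      using C_mult C_inv assms(2) by blast
    then show False
      using assms(1) c by (simp add: far_def group_word_simps)
  qed
  have "(x, y \<otimes> c) \<in> r"
  proof (rule ccontr)
    assume "(x, y \<otimes> c) \<notin> r"
    then have "(y \<otimes> c, x) \<in> r" using r_total c by auto
    then have "far (y \<otimes> c) y" by (rule le_far_trans) (rule assms(1))
    then show False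
      using C_inv[OF assms(2)] c by (simp add: far_def group_word_simps)
  qed
  with n show ?thesis by (simp add: far_def)
qed

lemma far_C_mult:
  assumes "far x y" "c \<in> C"
  shows "far (x \<otimes> c) y"
proof -
  have c: "x \<in> carrier G" "y \<in> carrier G" "c \<in> carrier G"
    using far_carrier[OF assms(1)] C_carrier[OF assms(2)] by auto
  have n: "inv (x \<otimes> c) \<otimes> y \<notin> C"
  proof
    assume "inv (x \<otimes> c) \<otimes> y \<in> C"
    then have "c \<otimes> (inv (x \<otimes> c) \<otimes> y) \<in> C"
      using C_mult assms(2) by blast
    then show False
      using assms(1) c by (simp add: far_def group_word_simps)
  qed
  have "(x \<otimes> c, y) \<in> r"
  proof (rule ccontr)
    assume "(x \<otimes> c, y) \<notin> r"
    then have "(y, x \<otimes> c) \<in> r" using r_total c by auto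
    then have "far x (x \<otimes> c)" by (rule far_le_trans[OF assms(1)])
    then show False
      using assms(2) c by (simp add: far_def group_word_simps)
  qed
  with n show ?thesis by (simp add: far_def)
qed

section \<open>Ping-pong sets\<close>

text \<open>The sets \<open>f \<otimes> I\<close> and \<open>g \<otimes> I\<close> must be separated modulo \<open>C\<close> and not just by \<open>r\<close>, so that the
  condition is the same for all orderings that agree with \<open>r\<close> outside \<open>C\<close>.\<close>

definition ping_pong :: "'a \<Rightarrow> 'a \<Rightarrow> 'a set \<Rightarrow> bool" where
  "ping_pong f g I \<longleftrightarrow> f \<in> carrier G \<and> g \<in> carrier G \<and> I \<noteq> {} \<and> I \<subseteq> carrier G \<and>
    (\<forall>x\<in>I. f \<otimes> x \<in> I \<and> g \<otimes> x \<in> I) \<and> (\<forall>x\<in>I. \<forall>y\<in>I. far (f \<otimes> x) (g \<otimes> y))"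

lemma ping_pongD:
  assumes "ping_pong f g I"
  shows "f \<in> carrier G" "g \<in> carrier G" "I \<noteq> {}" "x \<in> I \<Longrightarrow> x \<in> carrier G"
    "x \<in> I \<Longrightarrow> f \<otimes> x \<in> I" "x \<in> I \<Longrightarrow> g \<otimes> x \<in> I"
    "x \<in> I \<Longrightarrow> y \<in> I \<Longrightarrow> far (f \<otimes> x) (g \<otimes> y)"
  using assms unfolding ping_pong_def by blast+

text \<open>A ping-pong set contains smaller ones at its lower and at its upper end, namely the images
  \<open>f \<otimes> I\<close> and \<open>g \<otimes> I\<close>; the element that leaves the image is composed with the other one.\<close>

lemma ping_pong_lower:
  assumes "ping_pong f g I"
  shows "ping_pong f (f \<otimes> g) ((\<otimes>) f ` I)"
proof -
  note D = ping_pongD[OF assms]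
  have "far (f \<otimes> (f \<otimes> x)) (f \<otimes> g \<otimes> (f \<otimes> y))" if "x \<in> I" "y \<in> I" for x y
    using far_left[OF D(7) D(1), OF that(1) D(5)[OF that(2)]] D(1,2,4) that by (simp add: m_assoc)
  then show ?thesis
    using D by (auto simp: ping_pong_def m_assoc)
qed

lemma ping_pong_upper:
  assumes "ping_pong f g I"
  shows "ping_pong (g \<otimes> f) g ((\<otimes>) g ` I)"
proof -
  note D = ping_pongD[OF assms]
  have "far (g \<otimes> f \<otimes> (g \<otimes> x)) (g \<otimes> (g \<otimes> y))" if "x \<in> I" "y \<in> I" for x y
    using far_left[OF D(7) D(2), OF D(6)[OF that(1)] that(2)] D(1,2,4) that by (simp add: m_assoc)
  then show ?thesis
    using D by (auto simp: ping_pong_def m_assoc)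
qed

lemma ping_pong_translate:
  assumes "ping_pong f g I" and h: "h \<in> carrier G"
  shows "ping_pong (h \<otimes> f \<otimes> inv h) (h \<otimes> g \<otimes> inv h) ((\<otimes>) h ` I)"
proof -
  note D = ping_pongD[OF assms(1)]
  have "far (h \<otimes> f \<otimes> inv h \<otimes> (h \<otimes> x)) (h \<otimes> g \<otimes> inv h \<otimes> (h \<otimes> y))" if "x \<in> I" "y \<in> I" for x y
    using far_left[OF D(7) h, OF that] D(1,2,4) that h by (simp add: group_word_simps)
  then show ?thesis
    using D h by (auto simp: ping_pong_def group_word_simps)
qed

definition crossed :: "'a \<Rightarrow> 'a \<Rightarrow> bool" where
  "crossed a b \<longleftrightarrow> (\<exists>f g I. ping_pong f g I \<and> (\<forall>y\<in>I. (a, y) \<in> r \<and> (y, b) \<in> r))"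

lemma crossedI:
  "ping_pong f g I \<Longrightarrow> (\<And>y. y \<in> I \<Longrightarrow> (a, y) \<in> r) \<Longrightarrow> (\<And>y. y \<in> I \<Longrightarrow> (y, b) \<in> r) \<Longrightarrow> crossed a b"
  unfolding crossed_def by blast

lemma crossedE:
  assumes "crossed a b"
  obtains f g I where "ping_pong f g I" "\<And>y. y \<in> I \<Longrightarrow> (a, y) \<in> r" "\<And>y. y \<in> I \<Longrightarrow> (y, b) \<in> r"
  using assms unfolding crossed_def by blast

lemma crossed_mono:
  assumes "crossed b c" "(a, b) \<in> r" "(c, d) \<in> r"
  shows "crossed a d"
  using assms(1) by (rule crossedE) (blast intro: crossedI r_trans assms(2,3))

lemma crossed_translate:
  assumes "crossed a b" and h: "h \<in> carrier G"
  shows "crossed (h \<otimes> a) (h \<otimes> b)"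
  using assms(1)
proof (rule crossedE)
  fix f g I assume "ping_pong f g I" "\<And>y. y \<in> I \<Longrightarrow> (a, y) \<in> r" "\<And>y. y \<in> I \<Longrightarrow> (y, b) \<in> r"
  then show ?thesis
    using h by (intro crossedI[OF ping_pong_translate[of f g I]]) (auto intro: r_left)
qed

text \<open>Since \<open>f \<otimes> I\<close> lies below \<open>g \<otimes> I\<close>, the point \<open>b\<close> cannot cut both images: either \<open>f \<otimes> I\<close> lies
  below \<open>b\<close>, or some point of it, and hence all of \<open>g \<otimes> I\<close>, lies above \<open>b\<close>. Stated for arbitrary
  \<open>b\<close>, also outside the interval, this is transitivity of not being crossed.\<close>

lemma crossed_split:
  assumes "crossed a c" and b: "b \<in> carrier G"
  shows "crossed a b \<or> crossed b c"
proof -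
  obtain f g I where I: "ping_pong f g I" "\<And>y. y \<in> I \<Longrightarrow> (a, y) \<in> r" "\<And>y. y \<in> I \<Longrightarrow> (y, c) \<in> r"
    using assms(1) by (rule crossedE) blast
  note D = ping_pongD[OF I(1)]
  show ?thesis
  proof (cases "\<forall>x\<in>I. (f \<otimes> x, b) \<in> r")
    case True
    then have "crossed a b"
      using I(2) D(5) by (intro crossedI[OF ping_pong_lower[OF I(1)]]) auto
    then show ?thesis ..
  next
    case False
    then obtain x where x: "x \<in> I" "(f \<otimes> x, b) \<notin> r" by blast
    then have "(b, f \<otimes> x) \<in> r" using r_total b D(1,4) by auto
    then have "(b, g \<otimes> y) \<in> r" if "y \<in> I" for y
      using r_trans far_le[OF D(7)[OF x(1) that]] by blast
    then have "crossed b c"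
      using I(3) D(6) by (intro crossedI[OF ping_pong_upper[OF I(1)]]) auto
    then show ?thesis ..
  qed
qed

lemma not_crossed_if_ge:
  assumes "(b, a) \<in> r"
  shows "\<not> crossed a b"
proof
  assume "crossed a b"
  then obtain f g I where I: "ping_pong f g I" "\<And>y. y \<in> I \<Longrightarrow> (a, y) \<in> r" "\<And>y. y \<in> I \<Longrightarrow> (y, b) \<in> r"
    by (rule crossedE) blast
  note D = ping_pongD[OF I(1)]
  have eq: "y = a" if "y \<in> I" for y
    using r_trans[OF I(3)[OF that] assms] I(2)[OF that] r_antisym by blast
  obtain x where "x \<in> I" using D(3) by blast
  then have "far (f \<otimes> x) (g \<otimes> x)" "f \<otimes> x = a" "g \<otimes> x = a"
    using D(5-7) eq by blast+
  then show False using not_far_self by simp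
qed

text \<open>There is no ping-pong set between \<open>a\<close> and \<open>b\<close>, in whichever order they come: \<open>crossed a b\<close>
  concerns the interval from \<open>a\<close> up to \<open>b\<close>, which is empty or a point in one of the two cases.\<close>

definition linked :: "'a \<Rightarrow> 'a \<Rightarrow> bool" where
  "linked a b \<longleftrightarrow> a \<in> carrier G \<and> b \<in> carrier G \<and> \<not> crossed a b \<and> \<not> crossed b a"

lemma linked_trans: "linked a b \<Longrightarrow> linked b c \<Longrightarrow> linked a c"
  using crossed_split unfolding linked_def by blast

lemma linked_sym: "linked a b \<Longrightarrow> linked b a"
  unfolding linked_def by blast

lemma linked_translate:
  assumes "linked a b" and h: "h \<in> carrier G"
  shows "linked (h \<otimes> a) (h \<otimes> b)"
proof -
  have c: "a \<in> carrier G" "b \<in> carrier G" using assms(1) by (auto simp: linked_def)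
  have "crossed x y" if "crossed (h \<otimes> x) (h \<otimes> y)" "x \<in> carrier G" "y \<in> carrier G" for x y
    using crossed_translate[OF that(1), of "inv h"] h that by (simp add: inv_mult_cancel)
  then show ?thesis
    using assms c unfolding linked_def by blast
qed

lemma subgroup_linked: "subgroup {x. linked \<one> x} G"
proof
  have refl: "(\<one>, \<one>) \<in> r" using r_refl by simp
  show "{x. linked \<one> x} \<subseteq> carrier G" by (auto simp: linked_def)
  show "\<one> \<in> {x. linked \<one> x}" using not_crossed_if_ge[OF refl] by (simp add: linked_def)
  fix x assume x: "x \<in> {x. linked \<one> x}"
  then have c: "x \<in> carrier G" by (simp add: linked_def)
  have "linked (inv x \<otimes> \<one>) (inv x \<otimes> x)"
    using x c by (intro linked_translate) auto
  then show "inv x \<in> {x. linked \<one> x}"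
    using c linked_sym by simp
  fix y assume y: "y \<in> {x. linked \<one> x}"
  then have "linked (x \<otimes> \<one>) (x \<otimes> y)"
    using c by (intro linked_translate) auto
  then show "x \<otimes> y \<in> {x. linked \<one> x}"
    using linked_trans[of \<one> x "x \<otimes> y"] x c by simp
qed

lemma convex_linked: "order_convex G r {x. linked \<one> x}"
  unfolding order_convex_def
proof (intro conjI ballI impI)
  show "{x. linked \<one> x} \<subseteq> carrier G" by (auto simp: linked_def)
  fix a b x assume ab: "a \<in> {x. linked \<one> x}" "b \<in> {x. linked \<one> x}" and x: "x \<in> carrier G"
    and "(a, x) \<in> r - Id \<and> (x, b) \<in> r - Id"
  then have le: "(a, x) \<in> r" "(x, b) \<in> r" by auto
  have a: "a \<in> carrier G" using ab by (simp add: linked_def)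
  have "linked a b"
    using ab linked_trans linked_sym by blast
  then have "\<not> crossed a x"
    using crossed_mono[of a x a b] le r_refl[OF a] unfolding linked_def by blast
  then have "linked a x"
    using not_crossed_if_ge[OF le(1)] a x by (simp add: linked_def)
  then show "x \<in> {x. linked \<one> x}"
    using ab(1) linked_trans by blast
qed

text \<open>Non-Conradian pairs produce ping-pong sets: if no \<open>f \<otimes> g [^] n\<close> exceeds \<open>g\<close>,
  then \<open>f\<close> and \<open>g \<otimes> g\<close> play ping-pong on the interval from \<open>\<one>\<close> up to the powers of \<open>g\<close>, all of
  which are at most \<open>inv f \<otimes> g\<close>. If \<open>g\<close> lies above \<open>C\<close>, it separates the two images: \<open>f\<close> maps the
  interval to elements that are at most \<open>g\<close>, and \<open>g \<otimes> g\<close> maps it to elements whose cosets lie above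
  that of \<open>g\<close>. If \<open>g\<close> lies in \<open>C\<close>, either \<open>f\<close> does as well and \<open>C\<close> is Conradian, or \<open>f \<otimes> g\<close> lies
  above \<open>C\<close>.\<close>

lemma conradian_linked:
  assumes conr: "conradian (G\<lparr>carrier := C\<rparr>) (Restr r C)"
  shows "conradian (G\<lparr>carrier := {x. linked \<one> x}\<rparr>) (Restr r {x. linked \<one> x})"
  unfolding conradian_Restr_iff[OF subgroup_linked]
proof (intro ballI impI)
  fix f g assume fg: "f \<in> {x. linked \<one> x}" "g \<in> {x. linked \<one> x}"
    and pos: "(\<one>, f) \<in> r - Id \<and> (\<one>, g) \<in> r - Id"
  have c: "f \<in> carrier G" "g \<in> carrier G" using fg by (auto simp: linked_def)
  have f1: "(\<one>, f) \<in> r" and g1: "(\<one>, g) \<in> r" using pos by auto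
  show "\<exists>n::nat. n \<ge> 1 \<and> (g, f \<otimes> g [^] n) \<in> r - Id"
  proof (cases "g \<in> C")
    case gC: True
    show ?thesis
    proof (cases "f \<in> C")
      case True
      then show ?thesis
        using conr pos gC unfolding conradian_Restr_iff[OF subgroup_C] by blast
    next
      case False
      then have far: "far \<one> (f \<otimes> g)"
        using f1 gC far_mult_C[of \<one> f g] far_one_iff[of f] by simp
      have "(f \<otimes> g, g) \<notin> r"
        using far_le_trans[OF far] gC far_one_iff by blast
      then have "(g, f \<otimes> g) \<in> r - Id"
        using r_total[of "f \<otimes> g" g] r_refl[of g] c by auto
      then show ?thesis
        using c by (intro exI[of _ 1]) simp
    qed
  next
    case False
    then have farg: "far \<one> g" using g1 far_one_iff by simp
    show ?thesis
    proof (rule ccontr)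
      assume none: "\<not> ?thesis"
      have bound: "(f \<otimes> g [^] Suc n, g) \<in> r" for n
        using none r_total[of g "f \<otimes> g [^] Suc n"] r_refl[of g] c by fastforce
      have step: "(g [^] n, g [^] Suc n) \<in> r" for n :: nat
        using r_left[OF _ g1, of "g [^] n"] c by simp
      define I where "I = {y. (\<one>, y) \<in> r \<and> (\<exists>n::nat. (y, g [^] n) \<in> r)}"
      have Ic: "y \<in> carrier G" if "y \<in> I" for y
        using that r_carrier by (auto simp: I_def)
      have one: "\<one> \<in> I"
        using r_refl[of \<one>] by (auto simp: I_def intro!: exI[of _ 0])
      have fI: "(f \<otimes> y, g) \<in> r" if y: "y \<in> I" for y
      proof -
        obtain n :: nat where "(y, g [^] n) \<in> r" using y by (auto simp: I_def)
        then have "(y, g [^] Suc n) \<in> r" using step r_trans by blast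
        then show ?thesis using r_left[OF c(1)] bound r_trans by blast
      qed
      have above: "(h, h \<otimes> y) \<in> r" if "y \<in> I" "h \<in> carrier G" for y h
        using r_left[OF that(2), of \<one> y] that by (simp add: I_def)
      have "f \<otimes> y \<in> I" if "y \<in> I" for y
        using r_trans[OF f1 above[OF that c(1)]] fI[OF that] c
        by (auto simp: I_def intro!: exI[of _ 1])
      moreover have "g \<otimes> g \<otimes> y \<in> I" if y: "y \<in> I" for y
      proof -
        obtain n :: nat where "(y, g [^] n) \<in> r" using y by (auto simp: I_def)
        then have "(g \<otimes> g \<otimes> y, g \<otimes> g \<otimes> g [^] n) \<in> r" using r_left c by auto
        moreover have "g \<otimes> g \<otimes> g [^] n = g [^] Suc (Suc n)"
          using c nat_pow_Suc2[of g n] nat_pow_Suc2[of g "Suc n"]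
          by (simp del: nat_pow_Suc add: m_assoc)
        moreover have "(\<one>, g \<otimes> g) \<in> r"
          using r_trans[OF g1, of "g \<otimes> g"] r_left[OF c(2) g1] c by simp
        then have "(\<one>, g \<otimes> g \<otimes> y) \<in> r"
          using r_trans above[OF y, of "g \<otimes> g"] c by blast
        ultimately show ?thesis unfolding I_def mem_Collect_eq by metis
      qed
      moreover have "far (f \<otimes> x) (g \<otimes> g \<otimes> y)" if xy: "x \<in> I" "y \<in> I" for x y
      proof -
        have "far (g \<otimes> \<one>) (g \<otimes> (g \<otimes> y))"
          using far_left[OF far_le_trans[OF farg above[OF xy(2) c(2)]] c(2)] .
        then show ?thesis
          using le_far_trans[OF fI[OF xy(1)]] c Ic[OF xy(2)] by (simp add: m_assoc)
      qed
      ultimately have "ping_pong f (g \<otimes> g) I"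
        unfolding ping_pong_def using one c Ic by blast
      moreover have "(y, inv f \<otimes> g) \<in> r" if "y \<in> I" for y
        using r_left[OF _ fI[OF that], of "inv f"] c Ic[OF that] by (simp add: inv_mult_cancel)
      ultimately have "crossed \<one> (inv f \<otimes> g)"
        by (intro crossedI[of f "g \<otimes> g" I]) (auto simp: I_def)
      moreover have "inv f \<otimes> g \<in> {x. linked \<one> x}"
        using fg subgroup.m_closed[OF subgroup_linked] subgroup.m_inv_closed[OF subgroup_linked]
        by blast
      ultimately show False by (simp add: linked_def)
    qed
  qed
qed

text \<open>Otherwise \<open>x\<close> would be linked to \<open>\<one>\<close>, and the class of \<open>\<one>\<close> would be a convex Conradian subgroup
  strictly larger than the soul.\<close>

lemma crossed_above_conradian_soul:
  assumes soul: "is_conradian_soul G r C" and x: "(\<one>, x) \<in> r" "x \<notin> C"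
  shows "crossed \<one> x"
proof (rule ccontr)
  assume "\<not> crossed \<one> x"
  then have linked: "x \<in> {x. linked \<one> x}"
    using not_crossed_if_ge[OF x(1)] r_carrier[OF x(1)] by (simp add: linked_def)
  have "convex_conradian_subgroup G r {x. linked \<one> x}"
    using soul subgroup_linked convex_linked conradian_linked
    by (simp add: is_conradian_soul_def convex_conradian_subgroup_def)
  moreover have "C \<subseteq> {x. linked \<one> x}"
    using convex_subgroups_chain[OF ordering subgroup_C convex_C subgroup_linked convex_linked]
      linked x(2) by blast
  ultimately show False
    using soul linked x(2) unfolding is_conradian_soul_def by blast
qed

section \<open>Orderings that differ only on the convex subgroup\<close>

text \<open>The cones of all convex extensions to \<open>G\<close> of orderings of \<open>C\<close>: since \<open>s\<close> or \<open>inv s\<close> lies above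
  \<open>C\<close> for every \<open>s\<close> outside \<open>C\<close>, such a cone is determined outside \<open>C\<close>.\<close>

definition far_cones :: "'a set set" where
  "far_cones = {Q. ordering_cone G Q \<and> {s. far \<one> s} \<subseteq> Q}"

lemma far_cones_cone: "Q \<in> far_cones \<Longrightarrow> ordering_cone G Q"
  by (simp add: far_cones_def)

lemma far_cones_far:
  assumes "Q \<in> far_cones" "far x y"
  shows "inv x \<otimes> y \<in> Q"
  using assms far_iff_one[of x y] far_carrier[OF assms(2)] by (auto simp: far_cones_def)

lemma far_cones_not_far:
  assumes Q: "Q \<in> far_cones" and "far y x"
  shows "inv x \<otimes> y \<notin> Q"
  using ordering_cone_not_both[OF far_cones_cone[OF Q] far_cones_far[OF Q assms(2)]]
    far_carrier[OF assms(2)] by (auto simp: inv_mult_group)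

lemma far_cones_outside:
  assumes Q: "Q \<in> far_cones" and x: "x \<in> carrier G" "x \<notin> C"
  shows "x \<in> Q \<longleftrightarrow> far \<one> x"
proof
  assume "x \<in> Q"
  then have "inv x \<notin> Q"
    using ordering_cone_not_both[OF far_cones_cone[OF Q]] by blast
  then show "far \<one> x"
    using far_one_or_inv[OF x] Q by (auto simp: far_cones_def)
qed (use Q in \<open>auto simp: far_cones_def\<close>)

lemma positive_cone_in_far_cones: "positive_cone G r \<in> far_cones"
  using ordering_cone_positive_cone[OF ordering] far_le far_carrier not_far_self
  by (auto simp: far_cones_def positive_cone_def)

lemma far_cones_Int:
  assumes Q: "Q \<in> far_cones"
  shows "ordering_cone (G\<lparr>carrier := C\<rparr>) (Q \<inter> C)"
proof -
  have "conjugate_cone G \<one> Q = Q"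
    using ordering_coneD(1)[OF far_cones_cone[OF Q]] by (auto simp: conjugate_cone_def)
  then show ?thesis
    using ordering_cone_conjugate_Int_subgroup[OF far_cones_cone[OF Q] subgroup_C, of \<one>] by simp
qed

lemma Un_in_far_cones:
  assumes A: "ordering_cone (G\<lparr>carrier := C\<rparr>) A"
  shows "A \<union> {s. far \<one> s} \<in> far_cones"
proof -
  note AD = ordering_coneD[OF A, simplified]
  have AC: "a \<in> C" "a \<in> carrier G" if "a \<in> A" for a
    using AD(1)[OF that] C_carrier by auto
  have as: "far \<one> (a \<otimes> s)" if "a \<in> A" "far \<one> s" for a s
    using far_C_mult[OF far_left[OF that(2) AC(2)[OF that(1)]] C_inv[OF AC(1)[OF that(1)]]]
      AC(2)[OF that(1)] by simp
  have sa: "far \<one> (s \<otimes> a)" if "a \<in> A" "far \<one> s" for a s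
    using far_mult_C[OF that(2) AC(1)[OF that(1)]] .
  have st: "far \<one> (s \<otimes> t)" if "far \<one> s" "far \<one> t" for s t
    using far_trans[OF that(1)] far_left[OF that(2) far_carrier(2)[OF that(1)]]
      far_carrier(2)[OF that(1)] by simp
  have tot: "x = \<one> \<or> x \<in> A \<or> inv x \<in> A \<or> far \<one> x \<or> far \<one> (inv x)" if "x \<in> carrier G" for x
    using AD(4)[of x] far_one_or_inv[OF that] m_inv_consistent[OF subgroup_C, of x] by auto
  have "ordering_cone G (A \<union> {s. far \<one> s})"
    unfolding ordering_cone_def
  proof (intro conjI ballI)
    show "A \<union> {s. far \<one> s} \<subseteq> carrier G"
      using AC(2) far_carrier(2)[of \<one>] by blast
    show "\<one> \<notin> A \<union> {s. far \<one> s}"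
      using AD(2) not_far_self[of \<one>] by blast
  next
    fix x y assume "x \<in> A \<union> {s. far \<one> s}" "y \<in> A \<union> {s. far \<one> s}"
    then show "x \<otimes> y \<in> A \<union> {s. far \<one> s}"
      using as[of x y] sa[of y x] st[of x y] AD(3)[of x y] by auto
  next
    fix x assume "x \<in> carrier G"
    then show "x = \<one> \<or> x \<in> A \<union> {s. far \<one> s} \<or> inv x \<in> A \<union> {s. far \<one> s}"
      using tot[of x] by auto
  qed
  then show ?thesis
    by (simp add: far_cones_def)
qed

lemma finite_far_cones:
  assumes "finite (left_orderings (G\<lparr>carrier := C\<rparr>))"
  shows "finite far_cones"
proof -
  interpret C: group "G\<lparr>carrier := C\<rparr>"
    using subgroup.subgroup_is_group[OF subgroup_C] is_group by blast
  let ?h = "\<lambda>Q. cone_relation (G\<lparr>carrier := C\<rparr>) (Q \<inter> C)"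
  have pos: "positive_cone (G\<lparr>carrier := C\<rparr>) (?h Q) = Q \<inter> C" if "Q \<in> far_cones" for Q
    using far_cones_Int[OF that]
    by (intro C.positive_cone_cone_relation) (auto simp: ordering_cone_def)
  have "inj_on ?h far_cones"
  proof (rule inj_onI)
    fix Q R assume QR: "Q \<in> far_cones" "R \<in> far_cones" "?h Q = ?h R"
    then have Int: "Q \<inter> C = R \<inter> C" using pos by metis
    have "x \<in> Q \<longleftrightarrow> x \<in> R" if "x \<in> carrier G" for x
      using Int far_cones_outside[OF QR(1) that] far_cones_outside[OF QR(2) that] by blast
    then show "Q = R"
      using ordering_coneD(1)[OF far_cones_cone[OF QR(1)]]
        ordering_coneD(1)[OF far_cones_cone[OF QR(2)]] by blast
  qed
  moreover have "?h ` far_cones \<subseteq> left_orderings (G\<lparr>carrier := C\<rparr>)"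
    using C.cone_relation_in_left_orderings far_cones_Int by blast
  ultimately show ?thesis
    using assms finite_imageD finite_subset by blast
qed

text \<open>If all the conjugates by points of a ping-pong set \<open>I\<close> agreed outside \<open>C\<close>, an element outside
  \<open>C\<close> would move either all points of \<open>I\<close> up or all of them down. But \<open>f \<otimes> g\<close> and \<open>f \<otimes> (g \<otimes> g)\<close>
  move points in both directions. Hence they lie in \<open>C\<close>, and so do \<open>f\<close> and \<open>g\<close>; then \<open>g \<otimes> f\<close> and
  \<open>g\<close> violate Conrad's condition in one of the orderings that the orbits of points induce on \<open>C\<close>.\<close>

lemma ping_pong_conjugate_differs_outside:
  assumes fin: "finite (left_orderings (G\<lparr>carrier := C\<rparr>))" and Q: "Q \<in> far_cones"
    and I: "ping_pong f g I"
  shows "\<exists>w\<in>I. conjugate_cone G w Q \<notin> far_cones"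
proof (rule ccontr)
  assume "\<not> ?thesis"
  then have agree: "conjugate_cone G w Q \<in> far_cones" if "w \<in> I" for w
    using that by blast
  have mem: "a \<in> conjugate_cone G w Q" if "a \<in> carrier G" "far w (a \<otimes> w)" for a w
    using far_cones_far[OF Q that(2)] far_carrier(1)[OF that(2)] that(1)
    by (simp add: conjugate_cone_def m_assoc)
  have not_mem: "a \<notin> conjugate_cone G w Q" if "a \<in> carrier G" "far (a \<otimes> w) w" for a w
    using far_cones_not_far[OF Q that(2)] far_carrier(2)[OF that(2)] that(1)
    by (simp add: conjugate_cone_def m_assoc)
  note D = ping_pongD[OF I]
  obtain z where z: "z \<in> I" using D(3) by blast
  have in_C: "f \<otimes> h \<in> C" if h: "ping_pong f h I" for h
  proof (rule ccontr)
    note E = ping_pongD[OF h]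
    \<comment> \<open>The product moves \<open>h \<otimes> z\<close> down, since it maps \<open>I\<close> into \<open>f \<otimes> I\<close>. It moves
      \<open>f \<otimes> (f \<otimes> z)\<close> up, since \<open>h \<otimes> (f \<otimes> (f \<otimes> z))\<close> lies above \<open>f \<otimes> z\<close>.\<close>
    assume nC: "f \<otimes> h \<notin> C"
    have c: "f \<otimes> h \<in> carrier G" using E(1,2) by simp
    have "far (f \<otimes> (f \<otimes> z)) (f \<otimes> (h \<otimes> (f \<otimes> (f \<otimes> z))))"
      using far_left[OF E(7) E(1)] E(5) z by blast
    then have "f \<otimes> h \<in> conjugate_cone G (f \<otimes> (f \<otimes> z)) Q"
      using mem[OF c] E(1,2,4) z by (simp add: m_assoc)
    then have "far \<one> (f \<otimes> h)"
      using far_cones_outside[OF agree c nC] E(5) z by blast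
    then have "f \<otimes> h \<in> conjugate_cone G (h \<otimes> z) Q"
      using far_cones_outside[OF agree c nC] E(6) z by blast
    moreover have "far (f \<otimes> (h \<otimes> (h \<otimes> z))) (h \<otimes> z)"
      using E(6,7) z by blast
    then have "f \<otimes> h \<notin> conjugate_cone G (h \<otimes> z) Q"
      using not_mem[OF c] E(1,2,4) z by (simp add: m_assoc)
    ultimately show False by blast
  qed
  have gg: "ping_pong f (g \<otimes> g) I"
    using D by (auto simp: ping_pong_def m_assoc)
  have "inv (f \<otimes> g) \<otimes> (f \<otimes> (g \<otimes> g)) \<in> C" "f \<otimes> g \<in> C"
    using in_C[OF I] in_C[OF gg] C_mult C_inv by blast+
  moreover have "inv (f \<otimes> g) \<otimes> (f \<otimes> (g \<otimes> g)) = g" "f \<otimes> g \<otimes> inv g = f"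
    using D(1,2) by (simp_all add: group_word_simps)
  ultimately have fg: "f \<in> C" "g \<in> C"
    using C_mult C_inv by metis+
  \<comment> \<open>This point lies in \<open>g \<otimes> I\<close>, hence above \<open>f \<otimes> I\<close>, and it starts low enough, at
    \<open>f \<otimes> (f \<otimes> z)\<close>, for both \<open>g\<close> and \<open>g \<otimes> f\<close> to move it up. But \<open>g \<otimes> f \<otimes> g [^] n\<close> moves it
    below \<open>g \<otimes> w\<close> for all \<open>n\<close>.\<close>
  define w where "w = g \<otimes> (f \<otimes> (f \<otimes> z))"
  have w: "w \<in> I" "w \<in> carrier G" using D(4-6) z by (auto simp: w_def)
  have above: "far (f \<otimes> x) w" if "x \<in> I" for x
    unfolding w_def using D(5,7) z that by blast
  have "far w (g \<otimes> w)"
    unfolding w_def using far_left[OF above D(2)] D(5) z by (simp add: w_def)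
  then have 1: "g \<in> conjugate_cone G w Q \<inter> C"
    using mem fg D(2) by blast
  have "far w (g \<otimes> (f \<otimes> w))"
    using far_left[OF far_left[OF above D(1)] D(2)] z by (simp add: w_def)
  then have 2: "g \<otimes> f \<in> conjugate_cone G w Q \<inter> C"
    using mem[of "g \<otimes> f" w] fg C_mult D(1,2) w by (simp add: m_assoc)
  obtain n :: nat where n: "inv g \<otimes> (g \<otimes> f \<otimes> g [^] n) \<in> conjugate_cone G w Q \<inter> C"
    using ordering_cone_subgroup_conradian[OF subgroup_C fin
      ordering_cone_conjugate_Int_subgroup[OF far_cones_cone[OF Q] subgroup_C w(2)] 2 1] .
  have "g [^] n \<otimes> w \<in> I" for n :: nat
  proof (induction n)
    case (Suc n)
    then show ?case
      using D(2,6) w nat_pow_Suc2[OF D(2), of n] by (simp del: nat_pow_Suc add: m_assoc)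
  qed (use w in simp)
  then have "far (f \<otimes> g [^] n \<otimes> w) w"
    using above D(1,2) w by (simp add: m_assoc)
  then have "f \<otimes> g [^] n \<notin> conjugate_cone G w Q"
    using not_mem D(1,2) by simp
  then show False
    using n D(1,2) by (simp add: group_word_simps)
qed

lemma finite_has_least:
  assumes "finite B" "B \<noteq> {}" "B \<subseteq> carrier G"
  shows "\<exists>x\<in>B. \<forall>b\<in>B. (x, b) \<in> r"
  using assms
proof (induction B rule: finite_ne_induct)
  case (singleton x)
  then show ?case using r_refl by simp
next
  case (insert y B)
  then obtain x where x: "x \<in> B" "\<forall>b\<in>B. (x, b) \<in> r" by auto
  show ?case
  proof (cases "(x, y) \<in> r")
    case True
    then show ?thesis using x by blast
  next
    case False
    then have "(y, x) \<in> r" using r_total insert.prems x(1) by blast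
    then show ?thesis using x r_trans r_refl insert.prems by blast
  qed
qed

text \<open>Suppose not. Then each of the finitely many far cones \<open>P\<close> has a neighbourhood, given by a finite
  set \<open>F P\<close>, that contains no conjugate of \<open>Q\<close> except possibly \<open>P\<close>. Let \<open>x\<close> be the least element
  outside \<open>C\<close> that occurs in one of these sets. For \<open>w\<close> above \<open>C\<close> and at most \<open>x\<close>, the conjugate by
  \<open>w\<close> induces some ordering on \<open>C\<close> and keeps \<open>x\<close> and all elements above it positive, so it falls into the
  neighbourhood of the far cone with that restriction to \<open>C\<close>, and must be equal to it. A ping-pong
  set of such \<open>w\<close> gives a contradiction.\<close>

lemma far_cones_accumulate:
  assumes soul: "is_conradian_soul G r C" and proper: "C \<noteq> carrier G"
    and fin: "finite (left_orderings (G\<lparr>carrier := C\<rparr>))" and Q: "Q \<in> far_cones"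
  shows "\<exists>P\<in>far_cones. accumulates_at G Q P"
proof (rule ccontr)
  assume none: "\<not> ?thesis"
  have "\<forall>P\<in>far_cones. \<exists>F. finite F \<and> F \<subseteq> P \<and>
      (\<forall>w\<in>carrier G. F \<subseteq> conjugate_cone G w Q \<longrightarrow> conjugate_cone G w Q = P)"
  proof
    fix P assume "P \<in> far_cones"
    then have "\<not> accumulates_at G Q P" using none by blast
    then obtain F where "finite F" "F \<subseteq> P"
      "\<not> (\<exists>w\<in>carrier G. conjugate_cone G w Q \<noteq> P \<and> F \<subseteq> conjugate_cone G w Q)"
      unfolding accumulates_at_def by auto
    then show "\<exists>F. finite F \<and> F \<subseteq> P \<and>
        (\<forall>w\<in>carrier G. F \<subseteq> conjugate_cone G w Q \<longrightarrow> conjugate_cone G w Q = P)"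
      by (intro exI[of _ F]) auto
  qed
  then have "\<exists>F. \<forall>P\<in>far_cones. finite (F P) \<and> F P \<subseteq> P \<and>
      (\<forall>w\<in>carrier G. F P \<subseteq> conjugate_cone G w Q \<longrightarrow> conjugate_cone G w Q = P)"
    by (rule bchoice)
  then obtain F where all_F: "\<forall>P\<in>far_cones. finite (F P) \<and> F P \<subseteq> P \<and>
      (\<forall>w\<in>carrier G. F P \<subseteq> conjugate_cone G w Q \<longrightarrow> conjugate_cone G w Q = P)" ..
  have F: "finite (F P)" "F P \<subseteq> P"
    "w \<in> carrier G \<Longrightarrow> F P \<subseteq> conjugate_cone G w Q \<Longrightarrow> conjugate_cone G w Q = P"
    if "P \<in> far_cones" for P w
    using bspec[OF all_F that] by simp_all
  obtain s where s: "far \<one> s"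
    using proper far_one_or_inv C_carrier by blast
  \<comment> \<open>The element \<open>s\<close> is there in case all the sets \<open>F P\<close> lie in \<open>C\<close>.\<close>
  define B where "B = insert s ((\<Union>P\<in>far_cones. F P) - C)"
  have farB: "far \<one> b" if "b \<in> B" for b
  proof (cases "b = s")
    case False
    then obtain P where P: "P \<in> far_cones" "b \<in> P" "b \<notin> C"
      using \<open>b \<in> B\<close> F(2) unfolding B_def by blast
    then show ?thesis
      using far_cones_outside[OF P(1) _ P(3)] ordering_coneD(1)[OF far_cones_cone[OF P(1)] P(2)]
      by blast
  qed (use s in simp)
  have B: "finite B" "B \<noteq> {}" "B \<subseteq> carrier G"
    using finite_far_cones[OF fin] F(1) farB far_carrier(2) by (auto simp: B_def)
  then obtain x where x: "x \<in> B" "\<And>b. b \<in> B \<Longrightarrow> (x, b) \<in> r"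
    using finite_has_least[OF B] by blast
  have "(\<one>, x) \<in> r" "x \<notin> C" using farB[OF x(1)] by (auto simp: far_one_iff)
  from crossed_above_conradian_soul[OF soul this]
  obtain f g I where I: "ping_pong f g I" "\<And>y. y \<in> I \<Longrightarrow> (\<one>, y) \<in> r" "\<And>y. y \<in> I \<Longrightarrow> (y, x) \<in> r"
    by (rule crossedE) blast
  note D = ping_pongD[OF I(1)]
  have "conjugate_cone G w Q \<in> far_cones" if w: "w \<in> (\<otimes>) g ` I" for w
  proof -
    obtain y where y: "y \<in> I" "w = g \<otimes> y" using w by blast
    have wx: "(w, x) \<in> r"
      unfolding y(2) by (rule I(3)[OF D(6)[OF y(1)]])
    have w1: "far \<one> w"
      unfolding y(2) by (rule le_far_trans[OF I(2)[OF D(5)[OF y(1)]] D(7)[OF y(1) y(1)]])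
    have wc: "w \<in> carrier G" using far_carrier[OF w1] by simp
    \<comment> \<open>The far cone that induces the same ordering on \<open>C\<close> as the conjugate of \<open>Q\<close> by \<open>w\<close>.\<close>
    let ?P = "conjugate_cone G w Q \<inter> C \<union> {s. far \<one> s}"
    have P: "?P \<in> far_cones"
      by (intro Un_in_far_cones ordering_cone_conjugate_Int_subgroup far_cones_cone Q subgroup_C wc)
    have "b \<in> conjugate_cone G w Q" if b: "b \<in> F ?P" for b
    proof (cases "b \<in> C")
      case True
      then show ?thesis using b F(2)[OF P] by (auto simp: far_one_iff)
    next
      case False
      then have "b \<in> B" using b P by (auto simp: B_def)
      then have bc: "b \<in> carrier G" and "(w, b) \<in> r"
        using farB far_carrier(2) x(2) r_trans[OF wx] by blast+
      moreover have "far b (b \<otimes> w)"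
        using far_left[OF w1 bc] bc by simp
      ultimately show ?thesis
        using far_cones_far[OF Q le_far_trans] bc wc by (auto simp: conjugate_cone_def m_assoc)
    qed
    then have "conjugate_cone G w Q = ?P"
      using F(3)[OF P wc] by blast
    from this P show ?thesis by (rule ssubst[where P = "\<lambda>X. X \<in> far_cones"])
  qed
  \<comment> \<open>Only the upper image is certain to lie above \<open>C\<close>; points of \<open>I\<close> may belong to \<open>C\<close>.\<close>
  then show False
    using ping_pong_conjugate_differs_outside[OF fin Q ping_pong_upper[OF I(1)]] by blast
qed

end

section \<open>Approximation of a convex extension\<close>

theorem corollary2p10:
  fixes G :: "('a, 'b) monoid_scheme"
    and r :: "'a rel"
    and n :: nat
    and p :: "nat \<Rightarrow> 'a rel"
  assumes "group G"
    and "r \<in> left_orderings G"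
    and "\<not> conradian G r"
    and "conradian_soul G r \<noteq> {\<one>\<^bsub>G\<^esub>}"
    and "finite (left_orderings (G\<lparr>carrier := conradian_soul G r\<rparr>))"
    and "n \<ge> 1"
    and "bij_betw p {1..2 ^ n} (left_orderings (G\<lparr>carrier := conradian_soul G r\<rparr>))"
    and "p 1 = Restr r (conradian_soul G r)"
  shows "\<exists>j\<in>{1..2 ^ n}.
    approximated_by_conjugates G (convex_extension G (conradian_soul G r) (p j) r)"
proof -
  interpret group G by fact
  define C where "C = conradian_soul G r"
  note fin = assms(5)[folded C_def] and bij = assms(7)[folded C_def]
  have soul: "is_conradian_soul G r C"
    unfolding C_def by (rule is_conradian_soul_conradian_soul[OF assms(2)])
  interpret left_ordered_group_with_convex_subgroup G r C
    using soul assms(2)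
    by (intro left_ordered_group_with_convex_subgroup.intro
        left_ordered_group_with_convex_subgroup_axioms.intro group_axioms)
      (auto simp: is_conradian_soul_def convex_conradian_subgroup_def)
  interpret C: group "G\<lparr>carrier := C\<rparr>"
    using subgroup.subgroup_is_group[OF subgroup_C] is_group by blast
  have "r \<subseteq> carrier G \<times> carrier G" using r_carrier by auto
  then have "C \<noteq> carrier G"
    using soul assms(3)
    by (auto simp: is_conradian_soul_def convex_conradian_subgroup_def Int_absorb2)
  then obtain P where P: "P \<in> far_cones" and acc: "accumulates_at G P P"
    using minimal_orbit_closure_accumulates[OF finite_far_cones[OF fin]] far_cones_cone
      positive_cone_in_far_cones far_cones_accumulate[OF soul _ fin] by blast
  have cone_C: "ordering_cone (G\<lparr>carrier := C\<rparr>) (P \<inter> C)"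
    by (rule far_cones_Int[OF P])
  have "cone_relation (G\<lparr>carrier := C\<rparr>) (P \<inter> C) \<in> p ` {1..2 ^ n}"
    unfolding bij_betw_imp_surj_on[OF bij] by (rule C.cone_relation_in_left_orderings[OF cone_C])
  then obtain j where j: "j \<in> {1..2 ^ n}" "p j = cone_relation (G\<lparr>carrier := C\<rparr>) (P \<inter> C)"
    by fastforce
  have "positive_cone (G\<lparr>carrier := C\<rparr>) (p j) = P \<inter> C"
    unfolding j(2) using cone_C
    by (intro C.positive_cone_cone_relation) (auto simp: ordering_cone_def)
  then have inside: "(\<one>\<^bsub>G\<^esub>, f) \<in> p j - Id \<longleftrightarrow> f \<in> P" if "f \<in> C" for f
    using that by (auto simp: positive_cone_def)
  have outside: "(\<one>\<^bsub>G\<^esub>, f) \<in> r - Id \<longleftrightarrow> f \<in> P" if "f \<in> carrier G" "f \<notin> C" for f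
    using far_cones_outside[OF P that] that C_one by (auto simp: far_one_iff)
  have mem: "f \<in> {f \<in> carrier G. f \<in> C \<and> (\<one>\<^bsub>G\<^esub>, f) \<in> p j - Id \<or> f \<notin> C \<and> (\<one>\<^bsub>G\<^esub>, f) \<in> r - Id} \<longleftrightarrow> f \<in> P" for f
    using inside[of f] outside[of f] C_carrier[of f] ordering_coneD(1)[OF far_cones_cone[OF P], of f]
    by blast
  have "{f \<in> carrier G. f \<in> C \<and> (\<one>\<^bsub>G\<^esub>, f) \<in> p j - Id \<or> f \<notin> C \<and> (\<one>\<^bsub>G\<^esub>, f) \<in> r - Id} = P"
    by (rule Set.set_eqI) (rule mem)
  then have "convex_extension G C (p j) r = cone_relation G P"
    by (simp add: convex_extension_def)
  then have "approximated_by_conjugates G (convex_extension G C (p j) r)"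
    using approximated_by_conjugates_if_accumulates[OF far_cones_cone[OF P] acc] by simp
  then show ?thesis
    unfolding C_def using j(1) by (rule bexI)
qed

end
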